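(* For every formula $F$ of the language $\mathcal{L}$ of arithmetic, $\mathsf{HA}+\mathsf{MP}\vdash F$ if and only if $\mathsf{HA}+\mathsf{EM}_1^-\vdash F$.
   Context: The language $\mathcal{L}$: terms are variables, $0$, and $\mathsf{S}(t)$; there is a predicate symbol $\mathcal{P}$ for every primitive recursive relation on $\mathbb{N}$, with $\mathcal{P}^\bot$ the symbol for its complement; atomic formulas are $\mathcal{P}(t_1,\dots,t_n)$, and for atomic $P=\mathcal{P}(\vec t)$, $P^\bot:=\mathcal{P}^\bot(\vec t)$. Formulas are built from atomic formulas with $\land,\lor,\rightarrow,\forall,\exists$ (quantifiers over natural numbers); a propositional formula is quantifier-free, negative if $\lor$ does not occur in it; $\lnot A$ abbreviates $A\rightarrow\bot$ with $\bot$ a false atomic formula. $\mathsf{HA}$ is intuitionistic natural deduction over $\mathcal{L}$ with the induction rule (from $A(0)$ and $\forall\alpha(A(\alpha)\rightarrow A(\mathsf{S}\alpha))$ infer $A[m/\alpha]$) and Post rules (inferences among atomic formulas) for equality, the Peano axioms, classical propositional tautologies and booleans. $\mathsf{HA}+\mathsf{MP}$ adds the scheme $\lnot\lnot\exists\alpha\,P\rightarrow\exists\alpha\,P$ for $P$ atomic. $\mathsf{HA}+\mathsf{EM}_1^-$ adds instead the rule: from $\Gamma,\forall\alpha\,P\vdash\exists\beta\,Q$ and $\Gamma,\exists\alpha\,\lnot P\vdash\exists\beta\,Q$ infer $\Gamma\vdash\exists\beta\,Q$, for $P$ atomic and $Q$ negative propositional. *)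

theory Defs
  imports Main
begin

section \<open>Descriptions of primitive recursive functions\<close>

text \<open>
  As usual for Heyting arithmetic, the predicate symbols are introduced through definitions of
  primitive recursive functions, so that the axioms of the theory stay recursive. Different
  descriptions of the same function give different symbols.
\<close>

datatype prfun =
    PZero
  | PSucc
  | Proj nat nat              \<comment> \<open>\<open>Proj n i\<close>: the n-ary projection on argument i, counted from 0\<close>
  | Comp nat prfun "prfun list"   \<comment> \<open>\<open>Comp n f gs\<close>: the n-ary function f(g_1(xs),...,g_k(xs))\<close>
  | Rec prfun prfun

fun pr_arity :: "prfun \<Rightarrow> nat" where
  "pr_arity PZero = 0"
| "pr_arity PSucc = 1"
| "pr_arity (Proj n i) = n"
| "pr_arity (Comp n f gs) = n"
| "pr_arity (Rec g h) = Suc (pr_arity g)"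

fun wf_prfun :: "prfun \<Rightarrow> bool" where
  "wf_prfun PZero \<longleftrightarrow> True"
| "wf_prfun PSucc \<longleftrightarrow> True"
| "wf_prfun (Proj n i) \<longleftrightarrow> i < n"
| "wf_prfun (Comp n f gs) \<longleftrightarrow>
     wf_prfun f \<and> length gs = pr_arity f \<and> (\<forall>g\<in>set gs. wf_prfun g \<and> pr_arity g = n)"
| "wf_prfun (Rec g h) \<longleftrightarrow> wf_prfun g \<and> wf_prfun h \<and> pr_arity h = pr_arity g + 2"

fun pr_eval :: "prfun \<Rightarrow> nat list \<Rightarrow> nat" where
  "pr_eval PZero xs = 0"
| "pr_eval PSucc xs = Suc (hd xs)"
| "pr_eval (Proj n i) xs = xs ! i"
| "pr_eval (Comp n f gs) xs = pr_eval f (map (\<lambda>g. pr_eval g xs) gs)"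
| "pr_eval (Rec g h) xs =
     rec_nat (pr_eval g (tl xs)) (\<lambda>n r. pr_eval h (n # r # tl xs)) (hd xs)"

section \<open>The language\<close>

text \<open>Variables are de Bruijn indices.\<close>

datatype tm = Var nat | Zero | Succ tm

text \<open>
  \<open>Zeros f\<close> stands for the relation f(xs) = 0, so every primitive recursive relation has a symbol.
  Since terms contain no function symbols besides the successor, the defining equations of f are
  expressed with the symbol \<open>Graph f\<close> for the relation f(xs) = y. A symbol carries a
  sign, and complementation flips it.
\<close>

datatype rel = Eq | Graph prfun | Zeros prfun

datatype sym = Pos rel | Neg rel

fun rel_arity :: "rel \<Rightarrow> nat" where
  "rel_arity Eq = 2"
| "rel_arity (Graph f) = Suc (pr_arity f)"
| "rel_arity (Zeros f) = pr_arity f"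

fun wf_rel :: "rel \<Rightarrow> bool" where
  "wf_rel Eq \<longleftrightarrow> True"
| "wf_rel (Graph f) \<longleftrightarrow> wf_prfun f"
| "wf_rel (Zeros f) \<longleftrightarrow> wf_prfun f"

fun rel_holds :: "rel \<Rightarrow> nat list \<Rightarrow> bool" where
  "rel_holds Eq xs \<longleftrightarrow> xs ! 0 = xs ! 1"
| "rel_holds (Graph f) xs \<longleftrightarrow> pr_eval f (butlast xs) = last xs"
| "rel_holds (Zeros f) xs \<longleftrightarrow> pr_eval f xs = 0"

fun sym_rel :: "sym \<Rightarrow> rel" where
  "sym_rel (Pos R) = R"
| "sym_rel (Neg R) = R"

fun sym_holds :: "sym \<Rightarrow> nat list \<Rightarrow> bool" where
  "sym_holds (Pos R) xs \<longleftrightarrow> rel_holds R xs"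
| "sym_holds (Neg R) xs \<longleftrightarrow> \<not> rel_holds R xs"

text \<open>\<open>sym_holds\<close> fixes which relation on the naturals each symbol denotes; derivability does not use it.\<close>

fun compl_sym :: "sym \<Rightarrow> sym" where
  "compl_sym (Pos R) = Neg R"
| "compl_sym (Neg R) = Pos R"

lemma sym_holds_compl_sym: "sym_holds (compl_sym p) xs \<longleftrightarrow> \<not> sym_holds p xs"
  by (cases p) simp_all

lemma compl_sym_compl_sym: "compl_sym (compl_sym p) = p"
  by (cases p) simp_all

datatype atom = Atm sym "tm list"

fun wf_atom :: "atom \<Rightarrow> bool" where
  "wf_atom (Atm p ts) \<longleftrightarrow> wf_rel (sym_rel p) \<and> length ts = rel_arity (sym_rel p)"

fun compl :: "atom \<Rightarrow> atom" where
  "compl (Atm p ts) = Atm (compl_sym p) ts"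

abbreviation eq_atom :: "tm \<Rightarrow> tm \<Rightarrow> atom" where
  "eq_atom s t \<equiv> Atm (Pos Eq) [s, t]"

abbreviation graph_atom :: "prfun \<Rightarrow> tm list \<Rightarrow> tm \<Rightarrow> atom" where
  "graph_atom f ts t \<equiv> Atm (Pos (Graph f)) (ts @ [t])"

abbreviation zeros_atom :: "prfun \<Rightarrow> tm list \<Rightarrow> atom" where
  "zeros_atom f ts \<equiv> Atm (Pos (Zeros f)) ts"

definition bot_atom :: atom where
  "bot_atom = eq_atom Zero (Succ Zero)"

datatype fm =
    Atom atom
  | Conj fm fm
  | Disj fm fm
  | Impl fm fm
  | Forall fm
  | Exists fm

fun wf_fm :: "fm \<Rightarrow> bool" where
  "wf_fm (Atom P) \<longleftrightarrow> wf_atom P"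
| "wf_fm (Conj A B) \<longleftrightarrow> wf_fm A \<and> wf_fm B"
| "wf_fm (Disj A B) \<longleftrightarrow> wf_fm A \<and> wf_fm B"
| "wf_fm (Impl A B) \<longleftrightarrow> wf_fm A \<and> wf_fm B"
| "wf_fm (Forall A) \<longleftrightarrow> wf_fm A"
| "wf_fm (Exists A) \<longleftrightarrow> wf_fm A"

abbreviation Falsum :: fm where
  "Falsum \<equiv> Atom bot_atom"

abbreviation Neg_fm :: "fm \<Rightarrow> fm" where
  "Neg_fm A \<equiv> Impl A Falsum"

fun propositional :: "fm \<Rightarrow> bool" where
  "propositional (Atom P) \<longleftrightarrow> True"
| "propositional (Conj A B) \<longleftrightarrow> propositional A \<and> propositional B"
| "propositional (Disj A B) \<longleftrightarrow> propositional A \<and> propositional B"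
| "propositional (Impl A B) \<longleftrightarrow> propositional A \<and> propositional B"
| "propositional (Forall A) \<longleftrightarrow> False"
| "propositional (Exists A) \<longleftrightarrow> False"

fun or_free :: "fm \<Rightarrow> bool" where
  "or_free (Atom P) \<longleftrightarrow> True"
| "or_free (Conj A B) \<longleftrightarrow> or_free A \<and> or_free B"
| "or_free (Disj A B) \<longleftrightarrow> False"
| "or_free (Impl A B) \<longleftrightarrow> or_free A \<and> or_free B"
| "or_free (Forall A) \<longleftrightarrow> or_free A"
| "or_free (Exists A) \<longleftrightarrow> or_free A"

definition negative_propositional :: "fm \<Rightarrow> bool" where
  "negative_propositional A \<longleftrightarrow> propositional A \<and> or_free A"

section \<open>Substitution\<close>

fun tsubst :: "(nat \<Rightarrow> tm) \<Rightarrow> tm \<Rightarrow> tm" where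
  "tsubst \<sigma> (Var i) = \<sigma> i"
| "tsubst \<sigma> Zero = Zero"
| "tsubst \<sigma> (Succ t) = Succ (tsubst \<sigma> t)"

fun asubst :: "(nat \<Rightarrow> tm) \<Rightarrow> atom \<Rightarrow> atom" where
  "asubst \<sigma> (Atm p ts) = Atm p (map (tsubst \<sigma>) ts)"

definition shift :: "nat \<Rightarrow> tm" where
  "shift i = Var (Suc i)"

definition up :: "(nat \<Rightarrow> tm) \<Rightarrow> nat \<Rightarrow> tm" where
  "up \<sigma> = case_nat (Var 0) (\<lambda>i. tsubst shift (\<sigma> i))"

fun fsubst :: "(nat \<Rightarrow> tm) \<Rightarrow> fm \<Rightarrow> fm" where
  "fsubst \<sigma> (Atom P) = Atom (asubst \<sigma> P)"
| "fsubst \<sigma> (Conj A B) = Conj (fsubst \<sigma> A) (fsubst \<sigma> B)"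
| "fsubst \<sigma> (Disj A B) = Disj (fsubst \<sigma> A) (fsubst \<sigma> B)"
| "fsubst \<sigma> (Impl A B) = Impl (fsubst \<sigma> A) (fsubst \<sigma> B)"
| "fsubst \<sigma> (Forall A) = Forall (fsubst (up \<sigma>) A)"
| "fsubst \<sigma> (Exists A) = Exists (fsubst (up \<sigma>) A)"

text \<open>\<open>fsubst (inst t) A\<close> is A[t/a], where a is the variable bound by \<open>Forall A\<close> or \<open>Exists A\<close>;
  \<open>fsubst succ_bound A\<close> is A(S(a)), still in the scope of that binder.\<close>

definition inst :: "tm \<Rightarrow> nat \<Rightarrow> tm" where
  "inst t = case_nat t Var"

definition succ_bound :: "nat \<Rightarrow> tm" where
  "succ_bound = case_nat (Succ (Var 0)) shift"

section \<open>Post rules\<close>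

text \<open>
  \<open>post Ps P\<close>: from the atomic formulas \<open>Ps\<close> infer the atomic formula \<open>P\<close>. The Peano axioms
  include the defining equations of the primitive recursive functions. The rules named
  \<open>tautology\<close> and \<open>contrapos\<close> are those for classical propositional tautologies: the first
  contains every tautological consequence among atomic formulas, the second the other readings of
  an axiom that is an implication between atomic formulas, for example from s \<noteq> t infer
  S(s) \<noteq> S(t).
\<close>

inductive post :: "atom list \<Rightarrow> atom \<Rightarrow> bool" where
  eq_refl: "post [] (eq_atom t t)"
| eq_repl: "post [eq_atom s t, asubst (inst s) P] (asubst (inst t) P)"

| succ_inj: "post [eq_atom (Succ s) (Succ t)] (eq_atom s t)"
| succ_not_zero: "post [eq_atom Zero (Succ t)] bot_atom"

| graph_zero: "post [] (graph_atom PZero [] Zero)"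
| graph_succ: "post [] (graph_atom PSucc [t] (Succ t))"
| graph_proj: "i < n \<Longrightarrow> length ts = n \<Longrightarrow> post [] (graph_atom (Proj n i) ts (ts ! i))"
| graph_comp: "length us = length gs \<Longrightarrow>
    post (graph_atom f us t # map2 (\<lambda>g u. graph_atom g ts u) gs us) (graph_atom (Comp n f gs) ts t)"
| graph_rec_zero: "post [graph_atom g ts t] (graph_atom (Rec g h) (Zero # ts) t)"
| graph_rec_succ: "post [graph_atom (Rec g h) (s # ts) u, graph_atom h (s # u # ts) t]
    (graph_atom (Rec g h) (Succ s # ts) t)"
| graph_functional: "post [graph_atom f ts s, graph_atom f ts t] (eq_atom s t)"
| zeros_pos: "post [graph_atom f ts Zero] (zeros_atom f ts)"
| zeros_neg: "post [graph_atom f ts (Succ t)] (compl (zeros_atom f ts))"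

| tautology: "\<forall>v. (\<forall>Q. v (compl Q) \<longleftrightarrow> \<not> v Q) \<longrightarrow> (\<forall>Q\<in>set Ps. v Q) \<longrightarrow> v P \<Longrightarrow> post Ps P"
| contrapos: "post (Ps @ Q # Rs) P \<Longrightarrow> post (Ps @ compl P # Rs) (compl Q)"

| bool_true: "post [] (compl bot_atom)"
| bool_false: "post [bot_atom] P"

section \<open>Natural deduction\<close>

text \<open>
  \<open>deriv S \<Gamma> A\<close>: the formula \<open>A\<close> is derivable from the hypotheses \<open>\<Gamma>\<close> in the system \<open>S\<close>.
  The conditions \<open>wf_fm\<close> and \<open>wf_atom\<close> make sure that all formulas in a derivation respect the
  arities. Applying \<open>fsubst shift\<close> to the hypotheses and to the conclusion is the
  eigenvariable condition.
\<close>

datatype system = HA | HA_MP | HA_EM1_minus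

inductive deriv :: "system \<Rightarrow> fm list \<Rightarrow> fm \<Rightarrow> bool" for S :: system where
  Hyp: "A \<in> set \<Gamma> \<Longrightarrow> \<forall>B\<in>set \<Gamma>. wf_fm B \<Longrightarrow> deriv S \<Gamma> A"
| AndI: "deriv S \<Gamma> A \<Longrightarrow> deriv S \<Gamma> B \<Longrightarrow> deriv S \<Gamma> (Conj A B)"
| AndE1: "deriv S \<Gamma> (Conj A B) \<Longrightarrow> deriv S \<Gamma> A"
| AndE2: "deriv S \<Gamma> (Conj A B) \<Longrightarrow> deriv S \<Gamma> B"
| OrI1: "deriv S \<Gamma> A \<Longrightarrow> wf_fm B \<Longrightarrow> deriv S \<Gamma> (Disj A B)"
| OrI2: "deriv S \<Gamma> B \<Longrightarrow> wf_fm A \<Longrightarrow> deriv S \<Gamma> (Disj A B)"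
| OrE: "deriv S \<Gamma> (Disj A B) \<Longrightarrow> deriv S (A # \<Gamma>) C \<Longrightarrow> deriv S (B # \<Gamma>) C \<Longrightarrow> deriv S \<Gamma> C"
| ImpI: "deriv S (A # \<Gamma>) B \<Longrightarrow> deriv S \<Gamma> (Impl A B)"
| ImpE: "deriv S \<Gamma> (Impl A B) \<Longrightarrow> deriv S \<Gamma> A \<Longrightarrow> deriv S \<Gamma> B"
| AllI: "deriv S (map (fsubst shift) \<Gamma>) A \<Longrightarrow> deriv S \<Gamma> (Forall A)"
| AllE: "deriv S \<Gamma> (Forall A) \<Longrightarrow> deriv S \<Gamma> (fsubst (inst t) A)"
| ExI: "deriv S \<Gamma> (fsubst (inst t) A) \<Longrightarrow> deriv S \<Gamma> (Exists A)"
| ExE: "deriv S \<Gamma> (Exists A) \<Longrightarrow> deriv S (A # map (fsubst shift) \<Gamma>) (fsubst shift C) \<Longrightarrow> deriv S \<Gamma> C"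
| Induct: "deriv S \<Gamma> (fsubst (inst Zero) A) \<Longrightarrow> deriv S \<Gamma> (Forall (Impl A (fsubst succ_bound A))) \<Longrightarrow>
    deriv S \<Gamma> (fsubst (inst t) A)"
| Post: "post Ps P \<Longrightarrow> \<forall>Q\<in>set Ps. deriv S \<Gamma> (Atom Q) \<Longrightarrow> wf_atom P \<Longrightarrow> \<forall>B\<in>set \<Gamma>. wf_fm B \<Longrightarrow>
    deriv S \<Gamma> (Atom P)"
| MP: "S = HA_MP \<Longrightarrow> wf_atom P \<Longrightarrow> \<forall>B\<in>set \<Gamma>. wf_fm B \<Longrightarrow>
    deriv S \<Gamma> (Impl (Neg_fm (Neg_fm (Exists (Atom P)))) (Exists (Atom P)))"
| EM1_minus: "S = HA_EM1_minus \<Longrightarrow> negative_propositional Q \<Longrightarrow>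
    deriv S (Forall (Atom P) # \<Gamma>) (Exists Q) \<Longrightarrow> deriv S (Exists (Neg_fm (Atom P)) # \<Gamma>) (Exists Q) \<Longrightarrow>
    deriv S \<Gamma> (Exists Q)"

abbreviation provable :: "system \<Rightarrow> fm \<Rightarrow> bool" where
  "provable S F \<equiv> deriv S [] F"

end

(*
  Atomic formulas are decidable in HA: every primitive recursive function is provably total, and
  equality of numbers is decided by a primitive recursive function. Hence a negative propositional
  formula Q is provably equivalent to an atom, stating that the characteristic function of Q is 0.
  Markov's principle is therefore available for Q. If one Q-witness follows from (forall a. P) and
  one from (exists a. not P), then not (exists b. Q) would refute both; the second refutation yields
  (forall a. P) by decidability of P, a contradiction, so that Markov's principle gives exists b. Q.
  Conversely, Markov's principle for P is the EM_1^- rule for the complement of P.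
*)

theory Submission
  imports Defs
begin

section \<open>Substitution\<close>

text \<open>Two features of the language shape the proof. Post rules conclude atoms only, so the
  tautologies among them do not give the disjunction of an atom and its complement; decidability has
  to be read off from the value of a characteristic function. And in general no term denotes that
  value: it is accessible only through a \<open>Graph\<close> atom, so naming it means eliminating
  an existential quantifier, which renames the variables and enlarges the context. Hence the derived
  rules speak of all substitutions and contexts related by \<open>ext\<close>. Decidability is
  developed for an arbitrary system and so serves both directions. It also links two kinds of
  negation: Post rules work with the atom \<open>compl P\<close>, the excluded middle rule with the
  implication \<open>Neg_fm (Atom P)\<close>.\<close>

lemma up_simps [simp]: "up \<sigma> 0 = Var 0" "up \<sigma> (Suc i) = tsubst shift (\<sigma> i)"
  by (simp_all add: up_def)

lemma inst_simps [simp]: "inst t 0 = t" "inst t (Suc i) = Var i"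
  by (simp_all add: inst_def)

lemma succ_bound_simps [simp]: "succ_bound 0 = Succ (Var 0)" "succ_bound (Suc i) = Var (Suc i)"
  by (simp_all add: succ_bound_def shift_def)

lemma shift_apply [simp]: "shift i = Var (Suc i)"
  by (simp add: shift_def)

lemma tsubst_tsubst: "tsubst \<sigma> (tsubst \<tau> t) = tsubst (\<lambda>i. tsubst \<sigma> (\<tau> i)) t"
  by (induction t) simp_all

lemma tsubst_Var [simp]: "tsubst Var t = t"
  by (induction t) simp_all

lemma up_Var [simp]: "up Var = Var"
proof
  fix i show "up Var i = Var i" by (cases i) simp_all
qed

lemma tsubst_inst_shift [simp]: "tsubst (inst s) (tsubst shift t) = t"
  by (simp add: tsubst_tsubst)

lemma tsubst_up_shift: "tsubst (up \<sigma>) (tsubst shift t) = tsubst shift (tsubst \<sigma> t)"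
  by (simp add: tsubst_tsubst)

lemma up_comp: "(\<lambda>i. tsubst (up \<sigma>) (up \<tau> i)) = up (\<lambda>i. tsubst \<sigma> (\<tau> i))"
proof
  fix i show "tsubst (up \<sigma>) (up \<tau> i) = up (\<lambda>i. tsubst \<sigma> (\<tau> i)) i"
    by (cases i) (simp_all add: tsubst_up_shift)
qed

lemma asubst_asubst: "asubst \<sigma> (asubst \<tau> P) = asubst (\<lambda>i. tsubst \<sigma> (\<tau> i)) P"
  by (cases P) (simp add: tsubst_tsubst)

lemma asubst_Var [simp]: "asubst Var P = P"
  by (cases P) (simp add: map_idI)

lemma fsubst_fsubst: "fsubst \<sigma> (fsubst \<tau> A) = fsubst (\<lambda>i. tsubst \<sigma> (\<tau> i)) A"
  by (induction A arbitrary: \<sigma> \<tau>) (simp_all add: asubst_asubst up_comp)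

lemma fsubst_Var [simp]: "fsubst Var A = A"
  by (induction A) simp_all

lemma asubst_compl [simp]: "asubst \<sigma> (compl P) = compl (asubst \<sigma> P)"
  by (cases P) simp

lemma asubst_bot_atom [simp]: "asubst \<sigma> bot_atom = bot_atom"
  by (simp add: bot_atom_def)

lemma wf_atom_asubst [simp]: "wf_atom (asubst \<sigma> P) \<longleftrightarrow> wf_atom P"
  by (cases P) simp

lemma wf_atom_compl [simp]: "wf_atom (compl P) \<longleftrightarrow> wf_atom P"
proof (cases P)
  case (Atm p ts)
  then show ?thesis by (cases p) simp_all
qed

lemma wf_atom_bot_atom [simp]: "wf_atom bot_atom"
  by (simp add: bot_atom_def)

lemma wf_fm_fsubst [simp]: "wf_fm (fsubst \<sigma> A) \<longleftrightarrow> wf_fm A"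
  by (induction A arbitrary: \<sigma>) simp_all

lemma negative_propositional_fsubst:
  "negative_propositional A \<Longrightarrow> negative_propositional (fsubst \<sigma> A)"
  unfolding negative_propositional_def by (induction A arbitrary: \<sigma>) auto

lemma fsubst_inst: "fsubst \<sigma> (fsubst (inst t) A) = fsubst (inst (tsubst \<sigma> t)) (fsubst (up \<sigma>) A)"
proof -
  have "tsubst \<sigma> (inst t i) = tsubst (inst (tsubst \<sigma> t)) (up \<sigma> i)" for i
    by (cases i) simp_all
  then show ?thesis by (simp add: fsubst_fsubst)
qed

lemma asubst_inst: "asubst \<sigma> (asubst (inst t) P) = asubst (inst (tsubst \<sigma> t)) (asubst (up \<sigma>) P)"
  using fsubst_inst[of \<sigma> t "Atom P"] by simp

lemma fsubst_up_shift: "fsubst (up \<sigma>) (fsubst shift A) = fsubst shift (fsubst \<sigma> A)"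
  by (simp add: fsubst_fsubst)

lemma fsubst_up_succ_bound:
  "fsubst (up \<sigma>) (fsubst succ_bound A) = fsubst succ_bound (fsubst (up \<sigma>) A)"
proof -
  have "tsubst (up \<sigma>) (succ_bound i) = tsubst succ_bound (up \<sigma> i)" for i
  proof (cases i)
    case (Suc j)
    have "(\<lambda>i. tsubst succ_bound (shift i)) = shift"
      by (simp add: fun_eq_iff)
    with Suc show ?thesis by (simp add: tsubst_tsubst)
  qed simp
  then show ?thesis by (simp add: fsubst_fsubst)
qed

text \<open>\<open>case_nat x \<sigma>\<close> is the normal form for a body that is opened at
  \<open>x\<close> after its other variables were renamed by \<open>\<sigma>\<close>; the derived
  quantifier rules deliver bodies in this form.\<close>

lemma asubst_inst_up [simp]: "asubst (inst x) (asubst (up \<sigma>) P) = asubst (case_nat x \<sigma>) P"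
proof -
  have "tsubst (inst x) (up \<sigma> i) = case_nat x \<sigma> i" for i
    by (cases i) simp_all
  then show ?thesis by (simp add: asubst_asubst)
qed

lemma fsubst_inst_Var0: "fsubst (inst (Var 0)) (fsubst (up shift) A) = A"
proof -
  have "tsubst (inst (Var 0)) (up shift i) = Var i" for i
    by (cases i) simp_all
  then show ?thesis by (simp add: fsubst_fsubst)
qed

lemma post_asubst: "post Ps P \<Longrightarrow> post (map (asubst \<sigma>) Ps) (asubst \<sigma> P)"
proof (induction rule: post.induct)
  case (eq_repl s t P)
  \<comment> \<open>The replaced position of \<open>P\<close> is variable 0, so the substitution
    enters \<open>P\<close> under \<open>up\<close>.\<close>
  then show ?case
    using post.eq_repl[of "tsubst \<sigma> s" "tsubst \<sigma> t" "asubst (up \<sigma>) P"]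
    by (simp add: asubst_inst)
next
  case (graph_proj i n ts)
  then show ?case
    using post.graph_proj[of i n "map (tsubst \<sigma>) ts"] by simp
next
  case (graph_comp us gs f t ts n)
  have "map (asubst \<sigma>) (map2 (\<lambda>g u. graph_atom g ts u) gs us) =
      map2 (\<lambda>g u. graph_atom g (map (tsubst \<sigma>) ts) u) gs (map (tsubst \<sigma>) us)"
    by (auto simp: zip_map2)
  with post.graph_comp[of "map (tsubst \<sigma>) us" gs f "tsubst \<sigma> t" "map (tsubst \<sigma>) ts" n] graph_comp
  show ?case by simp
next
  case (tautology Ps P)
  show ?case
  proof (rule post.tautology, intro allI impI)
    fix v assume "\<forall>Q. v (compl Q) \<longleftrightarrow> \<not> v Q" "\<forall>Q\<in>set (map (asubst \<sigma>) Ps). v Q"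
    \<comment> \<open>Precomposing a valuation with the substitution gives a valuation that still
      respects \<open>compl\<close>, so the hypothesis applies to it.\<close>
    then show "v (asubst \<sigma> P)"
      using tautology[rule_format, of "\<lambda>Q. v (asubst \<sigma> Q)"] by auto
  qed
next
  case (contrapos Ps Q Rs P)
  then show ?case
    using post.contrapos[of "map (asubst \<sigma>) Ps" "asubst \<sigma> Q"] by simp
next
  case graph_zero
  then show ?case using post.graph_zero by simp
next
  case (graph_succ t)
  then show ?case using post.graph_succ by simp
next
  case (graph_rec_zero g ts t h)
  then show ?case using post.graph_rec_zero[of g "map (tsubst \<sigma>) ts" "tsubst \<sigma> t" h] by simp
next
  case (graph_rec_succ g h s ts u t)
  then show ?case
    using post.graph_rec_succ[of g h "tsubst \<sigma> s" "map (tsubst \<sigma>) ts"] by simp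
next
  case (zeros_neg f ts t)
  then show ?case using post.zeros_neg[of f "map (tsubst \<sigma>) ts" "tsubst \<sigma> t"] by simp
qed (auto intro: post.intros)


section \<open>Structural properties of derivations\<close>

definition wf_ctx :: "fm list \<Rightarrow> bool" where
  "wf_ctx \<Gamma> \<longleftrightarrow> (\<forall>B\<in>set \<Gamma>. wf_fm B)"

lemma wf_ctx_simps [simp]:
  "wf_ctx []" "wf_ctx (A # \<Gamma>) \<longleftrightarrow> wf_fm A \<and> wf_ctx \<Gamma>"
  "wf_ctx (map (fsubst \<sigma>) \<Gamma>) \<longleftrightarrow> wf_ctx \<Gamma>"
  by (simp_all add: wf_ctx_def)

lemma deriv_wf: "deriv S \<Gamma> A \<Longrightarrow> wf_ctx \<Gamma> \<and> wf_fm A"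
proof (induction rule: deriv.induct)
  case (Induct \<Gamma> A t)
  then show ?case by simp
qed (simp_all add: wf_ctx_def)

text \<open>Substitution and weakening in one relation. Contexts are compared as sets, so exchange
  and contraction are included, and two such steps compose to one.\<close>

definition ext :: "(nat \<Rightarrow> tm) \<Rightarrow> fm list \<Rightarrow> fm list \<Rightarrow> bool" where
  "ext \<sigma> \<Gamma> \<Delta> \<longleftrightarrow> fsubst \<sigma> ` set \<Gamma> \<subseteq> set \<Delta> \<and> wf_ctx \<Delta>"

lemma ext_Cons: "ext \<sigma> \<Gamma> \<Delta> \<Longrightarrow> wf_fm A \<Longrightarrow> ext \<sigma> (A # \<Gamma>) (fsubst \<sigma> A # \<Delta>)"
  by (auto simp: ext_def)

lemma ext_up: "ext \<sigma> \<Gamma> \<Delta> \<Longrightarrow> ext (up \<sigma>) (map (fsubst shift) \<Gamma>) (map (fsubst shift) \<Delta>)"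
  by (auto simp: ext_def fsubst_up_shift)

lemma ext_comp: "ext \<sigma> \<Gamma> \<Delta> \<Longrightarrow> ext \<tau> \<Delta> \<Theta> \<Longrightarrow> ext (\<lambda>i. tsubst \<tau> (\<sigma> i)) \<Gamma> \<Theta>"
  by (auto simp: ext_def simp flip: fsubst_fsubst)

lemma ext_wf: "ext \<sigma> \<Gamma> \<Delta> \<Longrightarrow> wf_ctx \<Delta>"
  by (simp add: ext_def)

text \<open>The structural properties come from one induction. Binders pass to
  \<open>up \<sigma>\<close>, which commutes with shifting; the excluded middle rule survives
  because substitution keeps a formula negative propositional.\<close>

lemma deriv_ext: "deriv S \<Gamma> A \<Longrightarrow> ext \<sigma> \<Gamma> \<Delta> \<Longrightarrow> deriv S \<Delta> (fsubst \<sigma> A)"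
proof (induction arbitrary: \<sigma> \<Delta> rule: deriv.induct)
  case (Hyp A \<Gamma>)
  then show ?case by (auto simp: ext_def wf_ctx_def intro!: deriv.Hyp)
next
  case (AndI \<Gamma> A B)
  then show ?case by (auto intro: deriv.AndI)
next
  case (AndE1 \<Gamma> A B)
  then show ?case by (auto intro: deriv.AndE1)
next
  case (AndE2 \<Gamma> A B)
  then show ?case by (auto intro: deriv.AndE2)
next
  case (OrI1 \<Gamma> A B)
  then show ?case by (auto intro: deriv.OrI1)
next
  case (OrI2 \<Gamma> B A)
  then show ?case by (auto intro: deriv.OrI2)
next
  case (OrE \<Gamma> A B C)
  have "wf_fm A" "wf_fm B" using deriv_wf[OF OrE.hyps(1)] by auto
  with OrE show ?case
    using deriv.OrE[of S \<Delta> "fsubst \<sigma> A" "fsubst \<sigma> B" "fsubst \<sigma> C"] by (simp add: ext_Cons)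
next
  case (ImpI A \<Gamma> B)
  have "wf_fm A" using deriv_wf[OF ImpI.hyps] by auto
  with ImpI show ?case by (auto intro!: deriv.ImpI simp: ext_Cons)
next
  case (ImpE \<Gamma> A B)
  then show ?case using deriv.ImpE[of S \<Delta> "fsubst \<sigma> A"] by simp
next
  case (AllI \<Gamma> A)
  then show ?case by (auto intro!: deriv.AllI simp: ext_up)
next
  case (AllE \<Gamma> A t)
  then show ?case using deriv.AllE[of S \<Delta> "fsubst (up \<sigma>) A"] by (simp add: fsubst_inst)
next
  case (ExI \<Gamma> t A)
  then show ?case using deriv.ExI[of S \<Delta> "tsubst \<sigma> t" "fsubst (up \<sigma>) A"] by (simp add: fsubst_inst)
next
  case (ExE \<Gamma> A C)
  have "wf_fm A" using deriv_wf[OF ExE.hyps(1)] by auto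
  then have "ext (up \<sigma>) (A # map (fsubst shift) \<Gamma>)
      (fsubst (up \<sigma>) A # map (fsubst shift) \<Delta>)"
    by (intro ext_Cons ext_up ExE.prems)
  from ExE.IH(2)[OF this] ExE.IH(1)[OF ExE.prems] show ?case
    using deriv.ExE[of S \<Delta> "fsubst (up \<sigma>) A"] by (simp add: fsubst_up_shift)
next
  case (Induct \<Gamma> A t)
  have "deriv S \<Delta> (fsubst (inst Zero) (fsubst (up \<sigma>) A))"
    using Induct.IH(1)[OF Induct.prems] by (simp add: fsubst_inst)
  moreover have "deriv S \<Delta> (Forall (Impl (fsubst (up \<sigma>) A) (fsubst succ_bound (fsubst (up \<sigma>) A))))"
    using Induct.IH(2)[OF Induct.prems] by (simp add: fsubst_up_succ_bound)
  ultimately show ?case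
    by (simp add: fsubst_inst deriv.Induct)
next
  case (Post Ps P \<Gamma>)
  show ?case unfolding fsubst.simps
  proof (rule deriv.Post)
    show "post (map (asubst \<sigma>) Ps) (asubst \<sigma> P)" using Post by (simp add: post_asubst)
  qed (use Post in \<open>auto simp: ext_def wf_ctx_def\<close>)
next
  case (MP P \<Gamma>)
  then show ?case by (auto intro: deriv.MP simp: ext_def wf_ctx_def)
next
  case (EM1_minus Q P \<Gamma>)
  have wf: "wf_fm (Forall (Atom P))" "wf_fm (Exists (Neg_fm (Atom P)))"
    using deriv_wf[OF EM1_minus.hyps(3)] by auto
  show ?case unfolding fsubst.simps
  proof (rule deriv.EM1_minus)
    show "negative_propositional (fsubst (up \<sigma>) Q)"
      using EM1_minus.hyps by (simp add: negative_propositional_fsubst)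
    show "deriv S (Forall (Atom (asubst (up \<sigma>) P)) # \<Delta>) (Exists (fsubst (up \<sigma>) Q))"
      using EM1_minus.IH(1)[OF ext_Cons[OF EM1_minus.prems wf(1)]] by simp
    show "deriv S (Exists (Neg_fm (Atom (asubst (up \<sigma>) P))) # \<Delta>) (Exists (fsubst (up \<sigma>) Q))"
      using EM1_minus.IH(2)[OF ext_Cons[OF EM1_minus.prems wf(2)]] by simp
  qed fact
qed

text \<open>
  The rules that discharge hypotheses are used in the following form, with an arbitrary extension
  of the context in place of the discharged formula, so that hypotheses appear as derivability
  statements.
\<close>

abbreviation weak :: "fm list \<Rightarrow> fm list \<Rightarrow> bool" (infix "\<sqsubseteq>" 50) where
  "\<Gamma> \<sqsubseteq> \<Delta> \<equiv> ext Var \<Gamma> \<Delta>"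

lemma weaken: "deriv S \<Gamma> A \<Longrightarrow> \<Gamma> \<sqsubseteq> \<Delta> \<Longrightarrow> deriv S \<Delta> A"
  using deriv_ext[of S \<Gamma> A Var] by simp

lemma ext_weak: "ext \<sigma> \<Gamma> \<Delta> \<Longrightarrow> \<Delta> \<sqsubseteq> \<Theta> \<Longrightarrow> ext \<sigma> \<Gamma> \<Theta>"
  by (auto simp: ext_def)

lemma weak_Cons: "wf_ctx \<Gamma> \<Longrightarrow> wf_fm A \<Longrightarrow> \<Gamma> \<sqsubseteq> A # \<Gamma>"
  by (auto simp: ext_def)

lemma ext_shift_Cons: "wf_ctx \<Gamma> \<Longrightarrow> wf_fm A \<Longrightarrow> ext shift \<Gamma> (A # map (fsubst shift) \<Gamma>)"
  by (auto simp: ext_def)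

lemma ext_shift_map: "wf_ctx \<Gamma> \<Longrightarrow> ext shift \<Gamma> (map (fsubst shift) \<Gamma>)"
  by (auto simp: ext_def)

lemma case_nat_shift: "case_nat (Var 0) shift = Var" "case_nat (Succ (Var 0)) shift = succ_bound"
  by (auto simp: fun_eq_iff succ_bound_def split: nat.split)

lemma deriv_hd: "wf_ctx \<Gamma> \<Longrightarrow> wf_fm A \<Longrightarrow> deriv S (A # \<Gamma>) A"
  by (auto intro!: deriv.Hyp simp: wf_ctx_def)

lemma Impl_intro:
  assumes "wf_ctx \<Gamma>" "wf_fm A" "\<And>\<Delta>. \<Gamma> \<sqsubseteq> \<Delta> \<Longrightarrow> deriv S \<Delta> A \<Longrightarrow> deriv S \<Delta> B"
  shows "deriv S \<Gamma> (Impl A B)"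
  using assms by (blast intro: deriv.ImpI weak_Cons deriv_hd)

lemma Disj_elim:
  assumes "deriv S \<Gamma> (Disj A B)"
    and "\<And>\<Delta>. \<Gamma> \<sqsubseteq> \<Delta> \<Longrightarrow> deriv S \<Delta> A \<Longrightarrow> deriv S \<Delta> C"
    and "\<And>\<Delta>. \<Gamma> \<sqsubseteq> \<Delta> \<Longrightarrow> deriv S \<Delta> B \<Longrightarrow> deriv S \<Delta> C"
  shows "deriv S \<Gamma> C"
proof -
  have "wf_ctx \<Gamma>" "wf_fm A" "wf_fm B" using deriv_wf[OF assms(1)] by auto
  with assms show ?thesis by (blast intro: deriv.OrE weak_Cons deriv_hd)
qed

text \<open>The eigenvariable is presented as an arbitrary term \<open>x\<close> and the shift as an
  arbitrary \<open>\<sigma>\<close>, although only \<open>x = Var 0\<close> with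
  \<open>\<sigma> = shift\<close> enters the proof. This hides the de Bruijn bookkeeping from later
  uses.\<close>

lemma Exists_elim:
  assumes "deriv S \<Gamma> (Exists A)"
    and "\<And>\<sigma> \<Delta> x. ext \<sigma> \<Gamma> \<Delta> \<Longrightarrow> deriv S \<Delta> (fsubst (case_nat x \<sigma>) A) \<Longrightarrow> deriv S \<Delta> (fsubst \<sigma> C)"
  shows "deriv S \<Gamma> C"
proof -
  have wf: "wf_ctx \<Gamma>" "wf_fm A" using deriv_wf[OF assms(1)] by auto
  then have "deriv S (A # map (fsubst shift) \<Gamma>) (fsubst (case_nat (Var 0) shift) A)"
    by (simp add: case_nat_shift deriv_hd)
  with wf show ?thesis
    using deriv.ExE[OF assms(1)] assms(2)[OF ext_shift_Cons] by blast
qed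

lemma Forall_intro:
  assumes "wf_ctx \<Gamma>" "\<And>\<sigma> \<Delta> x. ext \<sigma> \<Gamma> \<Delta> \<Longrightarrow> deriv S \<Delta> (fsubst (case_nat x \<sigma>) A)"
  shows "deriv S \<Gamma> (Forall A)"
  using deriv.AllI assms(2)[OF ext_shift_map[OF assms(1)], of "Var 0"]
  by (simp add: case_nat_shift)

lemma nat_induction:
  assumes "deriv S \<Gamma> (fsubst (inst Zero) A)"
    and "\<And>\<sigma> \<Delta> x. ext \<sigma> \<Gamma> \<Delta> \<Longrightarrow> deriv S \<Delta> (fsubst (case_nat x \<sigma>) A) \<Longrightarrow>
      deriv S \<Delta> (fsubst (case_nat (Succ x) \<sigma>) A)"
  shows "deriv S \<Gamma> (fsubst (inst t) A)"
proof -
  have wf: "wf_ctx \<Gamma>" "wf_fm A" using deriv_wf[OF assms(1)] by auto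
  have "deriv S (A # map (fsubst shift) \<Gamma>) (fsubst succ_bound A)"
    using assms(2)[OF ext_shift_Cons[OF wf], of "Var 0"] wf by (simp add: case_nat_shift deriv_hd)
  then show ?thesis
    by (intro deriv.Induct[OF assms(1)] deriv.AllI deriv.ImpI)
qed

text \<open>The calculus has ex falso for atoms only, through the Post rule
  \<open>bool_false\<close>, so the general case is an induction on the formula.\<close>

lemma Falsum_elim:
  assumes "deriv S \<Gamma> Falsum" "wf_fm A"
  shows "deriv S \<Gamma> A"
proof -
  \<comment> \<open>Opening a quantifier substitutes into its body, so the induction has to cover
    all instances \<open>fsubst \<sigma> A\<close>.\<close>
  have "deriv S \<Gamma> Falsum \<Longrightarrow> wf_fm A \<Longrightarrow> deriv S \<Gamma> (fsubst \<sigma> A)" for \<sigma>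
  proof (induction A arbitrary: \<Gamma> \<sigma>)
    case (Atom P)
    have "deriv S \<Gamma> (Atom (asubst \<sigma> P))"
      by (rule deriv.Post[OF post.bool_false]) (use Atom deriv_wf in \<open>auto simp: wf_ctx_def\<close>)
    then show ?case by simp
  next
    case (Conj A B)
    then show ?case by (simp add: deriv.AndI)
  next
    case (Disj A B)
    then show ?case by (simp add: deriv.OrI1)
  next
    case (Impl A B)
    have "wf_ctx \<Gamma>" using Impl.prems deriv_wf by blast
    then show ?case unfolding fsubst.simps
      by (rule Impl_intro) (use Impl weaken in auto)
  next
    case (Forall A)
    have "wf_ctx \<Gamma>" using Forall.prems deriv_wf by blast
    then show ?case unfolding fsubst.simps
    proof (rule Forall_intro)
      fix \<tau> \<Delta> x assume "ext \<tau> \<Gamma> \<Delta>"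
      then have "deriv S \<Delta> Falsum" using deriv_ext[OF Forall.prems(1)] by fastforce
      then show "deriv S \<Delta> (fsubst (case_nat x \<tau>) (fsubst (up \<sigma>) A))"
        using Forall by (simp add: fsubst_fsubst)
    qed
  next
    case (Exists A)
    have "deriv S \<Gamma> (fsubst (inst Zero) (fsubst (up \<sigma>) A))"
      using Exists by (simp add: fsubst_fsubst)
    then show ?case unfolding fsubst.simps by (rule deriv.ExI)
  qed
  from this[of Var] assms show ?thesis by simp
qed

lemma deriv_post:
  assumes "post Ps P" "\<And>Q. Q \<in> set Ps \<Longrightarrow> deriv S \<Gamma> (Atom Q)" "wf_ctx \<Gamma>" "wf_atom P"
  shows "deriv S \<Gamma> (Atom P)"
  using assms by (auto intro: deriv.Post simp: wf_ctx_def)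


section \<open>Totality of the primitive recursive functions\<close>

lemma tsubst_shift_comp [simp]:
  "tsubst (up \<sigma>) \<circ> tsubst shift = tsubst shift \<circ> tsubst \<sigma>"
  "tsubst (case_nat x \<sigma>) \<circ> tsubst shift = tsubst \<sigma>"
  "tsubst (inst x) \<circ> tsubst shift = id"
  "tsubst (case_nat x \<sigma>) \<circ> (tsubst shift \<circ> g) = tsubst \<sigma> \<circ> g"
  "tsubst (inst x) \<circ> (tsubst shift \<circ> g) = g"
  by (simp_all add: fun_eq_iff tsubst_tsubst)

lemma tsubst_case_nat_shift [simp]: "tsubst (case_nat x \<sigma>) (tsubst shift t) = tsubst \<sigma> t"
  by (simp add: tsubst_tsubst)

text \<open>A constant rather than an abbreviation, so that the list \<open>ts @ [t]\<close> stays
  hidden and substitution acts separately on arguments and value.\<close>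

definition graph_fm :: "prfun \<Rightarrow> tm list \<Rightarrow> tm \<Rightarrow> fm" where
  "graph_fm f ts t = Atom (graph_atom f ts t)"

definition defined_fm :: "prfun \<Rightarrow> tm list \<Rightarrow> fm" where
  "defined_fm f ts = Exists (graph_fm f (map (tsubst shift) ts) (Var 0))"

lemma fsubst_graph_fm [simp]:
  "fsubst \<sigma> (graph_fm f ts t) = graph_fm f (map (tsubst \<sigma>) ts) (tsubst \<sigma> t)"
  by (simp add: graph_fm_def)

lemma fsubst_defined_fm [simp]: "fsubst \<sigma> (defined_fm f ts) = defined_fm f (map (tsubst \<sigma>) ts)"
  by (simp add: defined_fm_def)

lemma wf_fm_graph_fm [simp]:
  "wf_fm (graph_fm f ts t) \<longleftrightarrow> wf_prfun f \<and> length ts = pr_arity f"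
  by (simp add: graph_fm_def)

lemma graph_fm_wf: "deriv S \<Gamma> (graph_fm f ts t) \<Longrightarrow> wf_ctx \<Gamma> \<and> wf_prfun f \<and> length ts = pr_arity f"
  using deriv_wf by fastforce

lemma defined_intro: "deriv S \<Gamma> (graph_fm f ts t) \<Longrightarrow> deriv S \<Gamma> (defined_fm f ts)"
  unfolding defined_fm_def by (rule deriv.ExI[of _ _ t]) simp

lemma defined_elim:
  assumes "deriv S \<Gamma> (defined_fm f ts)"
    and "\<And>\<sigma> \<Delta> u. ext \<sigma> \<Gamma> \<Delta> \<Longrightarrow> deriv S \<Delta> (graph_fm f (map (tsubst \<sigma>) ts) u) \<Longrightarrow>
      deriv S \<Delta> (fsubst \<sigma> C)"
  shows "deriv S \<Gamma> C"
  using assms(1) unfolding defined_fm_def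
  by (rule Exists_elim) (use assms(2) in simp)

lemma deriv_graph:
  assumes "post Ps (graph_atom f ts t)" "\<And>Q. Q \<in> set Ps \<Longrightarrow> deriv S \<Gamma> (Atom Q)"
    and "wf_ctx \<Gamma>" "wf_prfun f" "length ts = pr_arity f"
  shows "deriv S \<Gamma> (graph_fm f ts t)"
  unfolding graph_fm_def using assms by (auto intro: deriv_post)

lemma graph_PZero: "wf_ctx \<Gamma> \<Longrightarrow> deriv S \<Gamma> (graph_fm PZero [] Zero)"
  by (rule deriv_graph[OF post.graph_zero]) auto

lemma graph_PSucc: "wf_ctx \<Gamma> \<Longrightarrow> deriv S \<Gamma> (graph_fm PSucc [t] (Succ t))"
  by (rule deriv_graph[OF post.graph_succ]) auto

lemma graph_Proj:
  "wf_ctx \<Gamma> \<Longrightarrow> i < n \<Longrightarrow> length ts = n \<Longrightarrow> ts ! i = t \<Longrightarrow> deriv S \<Gamma> (graph_fm (Proj n i) ts t)"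
  using deriv_graph[OF post.graph_proj] by auto

lemma graph_Comp:
  assumes "deriv S \<Gamma> (graph_fm f us t)" "list_all2 (\<lambda>g u. deriv S \<Gamma> (graph_fm g ts u)) gs us"
    and "length ts = n"
  shows "deriv S \<Gamma> (graph_fm (Comp n f gs) ts t)"
proof (rule deriv_graph[OF post.graph_comp])
  show len: "length us = length gs" using assms(2) by (simp add: list_all2_lengthD)
  have gs: "\<forall>g\<in>set gs. wf_prfun g \<and> pr_arity g = n"
  proof
    fix g assume "g \<in> set gs"
    then obtain u where "deriv S \<Gamma> (graph_fm g ts u)"
      using assms(2) by (auto simp: list_all2_conv_all_nth in_set_conv_nth)
    then show "wf_prfun g \<and> pr_arity g = n"
      using graph_fm_wf[of S \<Gamma> g ts u] assms(3) by simp
  qed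
  show "wf_ctx \<Gamma>" "wf_prfun (Comp n f gs)" using assms(1) graph_fm_wf gs len by auto
  fix Q assume "Q \<in> set (graph_atom f us t # map2 (\<lambda>g u. graph_atom g ts u) gs us)"
  then consider "Q = graph_atom f us t" | g u where "Q = graph_atom g ts u" "(g, u) \<in> set (zip gs us)"
    by auto
  then show "deriv S \<Gamma> (Atom Q)"
    by cases (use assms in \<open>auto simp: graph_fm_def list_all2_iff\<close>)
qed (use assms in auto)

lemma graph_Rec_Zero:
  assumes "deriv S \<Gamma> (graph_fm g ts t)" "wf_prfun (Rec g h)"
  shows "deriv S \<Gamma> (graph_fm (Rec g h) (Zero # ts) t)"
  using assms(1)[THEN graph_fm_wf] assms
  by (intro deriv_graph[OF post.graph_rec_zero]) (auto simp: graph_fm_def)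

lemma graph_Rec_Succ:
  assumes "deriv S \<Gamma> (graph_fm (Rec g h) (s # ts) u)" "deriv S \<Gamma> (graph_fm h (s # u # ts) t)"
  shows "deriv S \<Gamma> (graph_fm (Rec g h) (Succ s # ts) t)"
  using assms(1)[THEN graph_fm_wf] assms
  by (intro deriv_graph[OF post.graph_rec_succ]) (auto simp: graph_fm_def)

lemma graph_functional:
  assumes "deriv S \<Gamma> (graph_fm f ts s)" "deriv S \<Gamma> (graph_fm f ts t)"
  shows "deriv S \<Gamma> (Atom (eq_atom s t))"
  by (rule deriv_post[OF post.graph_functional[of f ts s t]])
    (use assms graph_fm_wf in \<open>auto simp: graph_fm_def\<close>)

lemma graph_replace:
  assumes "deriv S \<Gamma> (Atom (eq_atom s t))" "deriv S \<Gamma> (graph_fm f ts s)"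
  shows "deriv S \<Gamma> (graph_fm f ts t)"
proof -
  \<comment> \<open>Only the value position is variable 0; the shifted arguments are untouched by
    the replacement.\<close>
  let ?P = "graph_atom f (map (tsubst shift) ts) (Var 0)"
  show ?thesis
    using deriv_graph[of "[eq_atom s t, asubst (inst s) ?P]" f ts t S \<Gamma>] assms
      post.eq_repl[of s t ?P] graph_fm_wf[OF assms(2)]
    by (auto simp: graph_fm_def)
qed

text \<open>For compositions, the values of the inner functions are named one after another. Each
  new name changes the context, so values found before are transported along and the substitutions
  compose.\<close>

lemma defined_list_elim:
  assumes "\<And>g \<Gamma> ts. g \<in> set gs \<Longrightarrow> wf_ctx \<Gamma> \<Longrightarrow> length ts = n \<Longrightarrow> deriv S \<Gamma> (defined_fm g ts)"
    and "wf_ctx \<Gamma>" "length ts = n"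
    and "\<And>\<sigma> \<Delta> us. ext \<sigma> \<Gamma> \<Delta> \<Longrightarrow>
      list_all2 (\<lambda>g u. deriv S \<Delta> (graph_fm g (map (tsubst \<sigma>) ts) u)) gs us \<Longrightarrow>
      deriv S \<Delta> (fsubst \<sigma> C)"
  shows "deriv S \<Gamma> C"
  using assms
proof (induction gs arbitrary: \<Gamma> ts C)
  case Nil
  from Nil.prems(4)[of Var \<Gamma> "[]"] Nil.prems(2) show ?case by (simp add: ext_def)
next
  case (Cons g gs)
  have "deriv S \<Gamma> (defined_fm g ts)" using Cons.prems by simp
  then show ?case
  proof (rule defined_elim)
    fix \<sigma> \<Delta> u
    assume 1: "ext \<sigma> \<Gamma> \<Delta>" "deriv S \<Delta> (graph_fm g (map (tsubst \<sigma>) ts) u)"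
    show "deriv S \<Delta> (fsubst \<sigma> C)"
    proof (rule Cons.IH[where ts = "map (tsubst \<sigma>) ts"])
      fix \<tau> \<Theta> us
      assume 2: "ext \<tau> \<Delta> \<Theta>"
        "list_all2 (\<lambda>g u. deriv S \<Theta> (graph_fm g (map (tsubst \<tau>) (map (tsubst \<sigma>) ts)) u)) gs us"
      have "tsubst \<tau> \<circ> tsubst \<sigma> = tsubst (\<lambda>i. tsubst \<tau> (\<sigma> i))"
        by (simp add: fun_eq_iff tsubst_tsubst)
      with 2 deriv_ext[OF 1(2) 2(1)]
      have "list_all2 (\<lambda>g u. deriv S \<Theta> (graph_fm g (map (tsubst (\<lambda>i. tsubst \<tau> (\<sigma> i))) ts) u))
          (g # gs) (tsubst \<tau> u # us)"
        by simp
      from Cons.prems(4)[OF ext_comp[OF 1(1) 2(1)] this]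
      show "deriv S \<Theta> (fsubst \<tau> (fsubst \<sigma> C))" by (simp add: fsubst_fsubst)
    qed (use Cons.prems 1 ext_wf in auto)
  qed
qed

text \<open>Induction on the description of the function, with an induction inside the system for a
  recursion.\<close>

lemma defined:
  "wf_prfun f \<Longrightarrow> length ts = pr_arity f \<Longrightarrow> wf_ctx \<Gamma> \<Longrightarrow> deriv S \<Gamma> (defined_fm f ts)"
proof (induction f arbitrary: ts \<Gamma>)
  case PZero
  then show ?case by (auto intro: defined_intro graph_PZero)
next
  case PSucc
  then obtain t where "ts = [t]" by (auto simp: length_Suc_conv)
  with PSucc show ?case by (auto intro: defined_intro graph_PSucc)
next
  case (Proj n i)
  then show ?case by (auto intro!: defined_intro graph_Proj)
next
  case (Comp n f gs)
  show ?case
  proof (rule defined_list_elim[where gs = gs and n = n and ts = ts])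
    fix \<sigma> \<Delta> us
    assume 1: "ext \<sigma> \<Gamma> \<Delta>"
      "list_all2 (\<lambda>g u. deriv S \<Delta> (graph_fm g (map (tsubst \<sigma>) ts) u)) gs us"
    have "deriv S \<Delta> (defined_fm f us)"
      using Comp 1 by (auto simp: ext_wf list_all2_lengthD)
    then show "deriv S \<Delta> (fsubst \<sigma> (defined_fm (Comp n f gs) ts))"
    proof (rule defined_elim)
      fix \<tau> \<Theta> u
      assume 2: "ext \<tau> \<Delta> \<Theta>" "deriv S \<Theta> (graph_fm f (map (tsubst \<tau>) us) u)"
      have "list_all2 (\<lambda>g u. deriv S \<Theta> (graph_fm g (map (tsubst \<tau>) (map (tsubst \<sigma>) ts)) u))
          gs (map (tsubst \<tau>) us)"
        using 1(2) deriv_ext[OF _ 2(1)] by (fastforce simp: list_all2_conv_all_nth)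
      from graph_Comp[OF 2(2) this, of n] Comp.prems
      have "deriv S \<Theta> (defined_fm (Comp n f gs) (map (tsubst \<tau>) (map (tsubst \<sigma>) ts)))"
        by (intro defined_intro) simp
      then show "deriv S \<Theta> (fsubst \<tau> (fsubst \<sigma> (defined_fm (Comp n f gs) ts)))" by simp
    qed
  qed (use Comp in auto)
next
  case (Rec g h)
  then obtain t ts' where ts: "ts = t # ts'" "length ts' = pr_arity g"
    by (auto simp: length_Suc_conv)
  \<comment> \<open>The recursion argument becomes variable 0 and the parameters are shifted, which
    gives the formula for the inner induction.\<close>
  have "deriv S \<Gamma> (fsubst (inst t) (defined_fm (Rec g h) (Var 0 # map (tsubst shift) ts')))"
  proof (rule nat_induction)
    have "deriv S \<Gamma> (defined_fm g ts')" using Rec ts by simp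
    then have "deriv S \<Gamma> (defined_fm (Rec g h) (Zero # ts'))"
      by (rule defined_elim) (use Rec in \<open>auto intro!: defined_intro graph_Rec_Zero\<close>)
    then show "deriv S \<Gamma> (fsubst (inst Zero) (defined_fm (Rec g h) (Var 0 # map (tsubst shift) ts')))"
      by simp
  next
    fix \<sigma> \<Delta> x
    let ?us = "map (tsubst \<sigma>) ts'"
    assume "ext \<sigma> \<Gamma> \<Delta>"
      "deriv S \<Delta> (fsubst (case_nat x \<sigma>) (defined_fm (Rec g h) (Var 0 # map (tsubst shift) ts')))"
    then have "deriv S \<Delta> (defined_fm (Rec g h) (x # ?us))" by simp
    then have "deriv S \<Delta> (defined_fm (Rec g h) (Succ x # ?us))"
    proof (rule defined_elim)
      fix \<tau> \<Theta> u
      let ?vs = "map (tsubst \<tau>) ?us"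
      assume "ext \<tau> \<Delta> \<Theta>" and *: "deriv S \<Theta> (graph_fm (Rec g h) (map (tsubst \<tau>) (x # ?us)) u)"
      then have "deriv S \<Theta> (defined_fm h (tsubst \<tau> x # u # ?vs))"
        using Rec ts by (auto simp: ext_wf)
      then have "deriv S \<Theta> (defined_fm (Rec g h) (Succ (tsubst \<tau> x) # ?vs))"
      proof (rule defined_elim)
        fix \<upsilon> \<Xi> v
        assume "ext \<upsilon> \<Theta> \<Xi>"
          and v: "deriv S \<Xi> (graph_fm h (map (tsubst \<upsilon>) (tsubst \<tau> x # u # ?vs)) v)"
        from deriv_ext[OF * this(1)] v
        show "deriv S \<Xi> (fsubst \<upsilon> (defined_fm (Rec g h) (Succ (tsubst \<tau> x) # ?vs)))"
          using graph_Rec_Succ by (fastforce intro: defined_intro)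
      qed
      then show "deriv S \<Theta> (fsubst \<tau> (defined_fm (Rec g h) (Succ x # ?us)))" by simp
    qed
    then show "deriv S \<Delta> (fsubst (case_nat (Succ x) \<sigma>)
        (defined_fm (Rec g h) (Var 0 # map (tsubst shift) ts')))" by simp
  qed
  then show ?case by (simp add: ts)
qed

lemma value_elim:
  assumes "wf_prfun f" "length ts = pr_arity f" "wf_ctx \<Gamma>"
    and "\<And>\<sigma> \<Delta> u. ext \<sigma> \<Gamma> \<Delta> \<Longrightarrow> deriv S \<Delta> (graph_fm f (map (tsubst \<sigma>) ts) u) \<Longrightarrow>
      deriv S \<Delta> (fsubst \<sigma> C)"
  shows "deriv S \<Gamma> C"
  using defined_elim[OF defined[OF assms(1-3)]] assms(4) by blast

text \<open>The rule at a successor asks for a value at the predecessor even if the result does not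
  depend on it. Totality supplies one, so functions defined by cases need no induction of their
  own.\<close>

lemma graph_Rec_Succ_const:
  assumes "wf_prfun (Rec g h)" "length ts = pr_arity g" "wf_ctx \<Gamma>"
    and "\<And>\<sigma> \<Delta> u. ext \<sigma> \<Gamma> \<Delta> \<Longrightarrow>
      deriv S \<Delta> (graph_fm h (tsubst \<sigma> s # u # map (tsubst \<sigma>) ts) (tsubst \<sigma> t))"
  shows "deriv S \<Gamma> (graph_fm (Rec g h) (Succ s # ts) t)"
proof (rule value_elim[where f = "Rec g h" and ts = "s # ts"])
  fix \<sigma> \<Delta> u
  assume "ext \<sigma> \<Gamma> \<Delta>" "deriv S \<Delta> (graph_fm (Rec g h) (map (tsubst \<sigma>) (s # ts)) u)"
  then show "deriv S \<Delta> (fsubst \<sigma> (graph_fm (Rec g h) (Succ s # ts) t))"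
    using graph_Rec_Succ assms(4) by simp
qed (use assms in auto)


section \<open>Decidability of the atomic formulas\<close>

text \<open>The value is recorded next to the decided formula because a composition needs the values
  of its parts.\<close>

definition dec_fm :: "prfun \<Rightarrow> tm list \<Rightarrow> fm \<Rightarrow> fm \<Rightarrow> fm" where
  "dec_fm f ts A B = Disj (Conj (graph_fm f ts Zero) A) (Conj (graph_fm f ts (Succ Zero)) B)"

lemma fsubst_dec_fm [simp]:
  "fsubst \<sigma> (dec_fm f ts A B) = dec_fm f (map (tsubst \<sigma>) ts) (fsubst \<sigma> A) (fsubst \<sigma> B)"
  by (simp add: dec_fm_def)

lemma dec_intro1:
  "deriv S \<Gamma> (graph_fm f ts Zero) \<Longrightarrow> deriv S \<Gamma> A \<Longrightarrow> wf_fm B \<Longrightarrow> deriv S \<Gamma> (dec_fm f ts A B)"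
  unfolding dec_fm_def by (auto intro!: deriv.OrI1 deriv.AndI dest: graph_fm_wf)

lemma dec_intro2:
  "deriv S \<Gamma> (graph_fm f ts (Succ Zero)) \<Longrightarrow> deriv S \<Gamma> B \<Longrightarrow> wf_fm A \<Longrightarrow>
    deriv S \<Gamma> (dec_fm f ts A B)"
  unfolding dec_fm_def by (auto intro!: deriv.OrI2 deriv.AndI dest: graph_fm_wf)

lemma dec_elim:
  assumes "deriv S \<Gamma> (dec_fm f ts A B)"
    and "\<And>\<Delta>. \<Gamma> \<sqsubseteq> \<Delta> \<Longrightarrow> deriv S \<Delta> (graph_fm f ts Zero) \<Longrightarrow> deriv S \<Delta> A \<Longrightarrow> deriv S \<Delta> C"
    and "\<And>\<Delta>. \<Gamma> \<sqsubseteq> \<Delta> \<Longrightarrow> deriv S \<Delta> (graph_fm f ts (Succ Zero)) \<Longrightarrow> deriv S \<Delta> B \<Longrightarrow> deriv S \<Delta> C"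
  shows "deriv S \<Gamma> C"
  using assms(1) unfolding dec_fm_def
  by (rule Disj_elim) (auto intro: assms(2,3) dest: deriv.AndE1 deriv.AndE2)

lemma nat_cases:
  assumes "deriv S \<Gamma> (fsubst (inst Zero) A)"
    and "\<And>\<sigma> \<Delta> x. ext \<sigma> \<Gamma> \<Delta> \<Longrightarrow> deriv S \<Delta> (fsubst (case_nat (Succ x) \<sigma>) A)"
  shows "deriv S \<Gamma> (fsubst (inst t) A)"
  using assms by (rule nat_induction)

section \<open>Sign, predecessor, truncated difference and inequality\<close>

definition const0 :: "nat \<Rightarrow> prfun" where
  "const0 n = Comp n PZero []"

definition const1 :: "nat \<Rightarrow> prfun" where
  "const1 n = Comp n PSucc [const0 n]"

lemma const_simps [simp]:
  "wf_prfun (const0 n)" "pr_arity (const0 n) = n" "wf_prfun (const1 n)" "pr_arity (const1 n) = n"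
  by (simp_all add: const0_def const1_def)

lemma graph_const0: "wf_ctx \<Gamma> \<Longrightarrow> length ts = n \<Longrightarrow> deriv S \<Gamma> (graph_fm (const0 n) ts Zero)"
  unfolding const0_def by (auto intro!: graph_Comp graph_PZero)

lemma graph_const1: "wf_ctx \<Gamma> \<Longrightarrow> length ts = n \<Longrightarrow> deriv S \<Gamma> (graph_fm (const1 n) ts (Succ Zero))"
  unfolding const1_def by (auto intro!: graph_Comp[where us = "[Zero]"] graph_PSucc graph_const0)

definition sg :: prfun where
  "sg = Rec (const0 0) (const1 2)"

definition pred :: prfun where
  "pred = Rec PZero (Proj 2 0)"

text \<open>The value is 0 at 1, and 1 elsewhere. The inner recursion is only a case distinction on
  the predecessor.\<close>

definition neq1 :: prfun where
  "neq1 = Rec (const1 0) (Rec (const0 1) (const1 3))"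

text \<open>
  The truncated difference S(y) - x, by recursion on x. It is 1 if and only if x = y, so comparing
  it with 1 tests equality, although primitive recursion descends in one argument only.
\<close>

definition diff :: prfun where
  "diff = Rec PSucc (Comp 3 pred [Proj 3 1])"

definition neq :: prfun where
  "neq = Comp 2 neq1 [diff]"

lemma arith_simps [simp]:
  "wf_prfun sg" "pr_arity sg = 1" "wf_prfun pred" "pr_arity pred = 1"
  "wf_prfun neq1" "pr_arity neq1 = 1" "wf_prfun diff" "pr_arity diff = 2"
  "wf_prfun neq" "pr_arity neq = 2"
  by (simp_all add: sg_def pred_def neq1_def diff_def neq_def numeral_2_eq_2 numeral_3_eq_3)

lemma graph_sg_Zero: "wf_ctx \<Gamma> \<Longrightarrow> deriv S \<Gamma> (graph_fm sg [Zero] Zero)"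
  unfolding sg_def by (auto intro!: graph_Rec_Zero graph_const0)

lemma graph_sg_Succ: "wf_ctx \<Gamma> \<Longrightarrow> deriv S \<Gamma> (graph_fm sg [Succ t] (Succ Zero))"
  unfolding sg_def by (auto intro!: graph_Rec_Succ_const graph_const1 simp: ext_wf)

lemma graph_pred_Zero: "wf_ctx \<Gamma> \<Longrightarrow> deriv S \<Gamma> (graph_fm pred [Zero] Zero)"
  unfolding pred_def by (auto intro!: graph_Rec_Zero graph_PZero)

lemma graph_pred_Succ: "wf_ctx \<Gamma> \<Longrightarrow> deriv S \<Gamma> (graph_fm pred [Succ t] t)"
  unfolding pred_def by (auto intro!: graph_Rec_Succ_const graph_Proj simp: ext_wf)

lemma graph_neq1_Zero: "wf_ctx \<Gamma> \<Longrightarrow> deriv S \<Gamma> (graph_fm neq1 [Zero] (Succ Zero))"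
  unfolding neq1_def by (auto intro!: graph_Rec_Zero graph_const1)

lemma graph_neq1_Succ_Zero: "wf_ctx \<Gamma> \<Longrightarrow> deriv S \<Gamma> (graph_fm neq1 [Succ Zero] Zero)"
  unfolding neq1_def
  by (auto intro!: graph_Rec_Succ_const graph_Rec_Zero graph_const0 simp: ext_wf)

lemma graph_neq1_Succ_Succ:
  "wf_ctx \<Gamma> \<Longrightarrow> deriv S \<Gamma> (graph_fm neq1 [Succ (Succ t)] (Succ Zero))"
  unfolding neq1_def
  by (auto intro!: graph_Rec_Succ_const graph_const1 simp: ext_wf)

lemma graph_diff_Zero: "wf_ctx \<Gamma> \<Longrightarrow> deriv S \<Gamma> (graph_fm diff [Zero, t] (Succ t))"
  unfolding diff_def by (auto intro!: graph_Rec_Zero graph_PSucc)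

lemma graph_diff_Succ:
  assumes "deriv S \<Gamma> (graph_fm diff [s, t] u)" "deriv S \<Gamma> (graph_fm pred [u] v)"
  shows "deriv S \<Gamma> (graph_fm diff [Succ s, t] v)"
proof -
  have "deriv S \<Gamma> (graph_fm (Comp 3 pred [Proj 3 1]) [s, u, t] v)"
    using assms(2) graph_fm_wf[OF assms(1)]
    by (auto intro!: graph_Comp[where us = "[u]"] graph_Proj)
  with assms(1) show ?thesis unfolding diff_def by (rule graph_Rec_Succ)
qed

lemma graph_diff_Succ_Zero:
  assumes "wf_ctx \<Gamma>"
  shows "deriv S \<Gamma> (graph_fm diff [Succ t, Zero] Zero)"
proof -
  have "deriv S \<Gamma> (fsubst (inst t) (graph_fm diff [Succ (Var 0), Zero] Zero))"
  proof (rule nat_induction)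
    show "deriv S \<Gamma> (fsubst (inst Zero) (graph_fm diff [Succ (Var 0), Zero] Zero))"
      using graph_diff_Succ[OF graph_diff_Zero graph_pred_Succ] assms by simp
  next
    fix \<sigma> \<Delta> x
    assume "ext \<sigma> \<Gamma> \<Delta>"
      "deriv S \<Delta> (fsubst (case_nat x \<sigma>) (graph_fm diff [Succ (Var 0), Zero] Zero))"
    then show "deriv S \<Delta> (fsubst (case_nat (Succ x) \<sigma>) (graph_fm diff [Succ (Var 0), Zero] Zero))"
      using graph_diff_Succ graph_pred_Zero ext_wf by fastforce
  qed
  then show ?thesis by simp
qed

text \<open>The recursion of \<open>diff\<close> runs on the first argument with the second fixed,
  so invariance under a successor on both sides is not among its equations and takes an induction on
  \<open>s\<close>. Without a term for the difference, the claim is that both sides have a common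
  value.\<close>

lemma diff_Succ_Succ:
  assumes "wf_ctx \<Gamma>"
  shows "deriv S \<Gamma> (Exists (Conj
    (graph_fm diff [Succ (tsubst shift s), Succ (tsubst shift t)] (Var 0))
    (graph_fm diff [tsubst shift s, tsubst shift t] (Var 0))))"
proof -
  define F where "F s t = Exists (Conj
    (graph_fm diff [Succ (tsubst shift s), Succ (tsubst shift t)] (Var 0))
    (graph_fm diff [tsubst shift s, tsubst shift t] (Var 0)))" for s t
  have F_subst: "fsubst \<sigma> (F s t) = F (tsubst \<sigma> s) (tsubst \<sigma> t)" for \<sigma> s t
    by (simp add: F_def tsubst_up_shift)
  have F_intro: "deriv S \<Delta> (F s t)"
    if "deriv S \<Delta> (graph_fm diff [Succ s, Succ t] u)" "deriv S \<Delta> (graph_fm diff [s, t] u)"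
    for \<Delta> s t u
    unfolding F_def using that by (intro deriv.ExI[of _ _ u]) (simp add: deriv.AndI)
  have "deriv S \<Gamma> (fsubst (inst s) (F (Var 0) (tsubst shift t)))"
  proof (rule nat_induction)
    \<comment> \<open>The common value is \<open>Succ t\<close>, on one side as the predecessor of
      \<open>Succ (Succ t)\<close>.\<close>
    have "deriv S \<Gamma> (F Zero t)"
      using assms
      by (intro F_intro[OF graph_diff_Succ[OF graph_diff_Zero graph_pred_Succ] graph_diff_Zero])
    then show "deriv S \<Gamma> (fsubst (inst Zero) (F (Var 0) (tsubst shift t)))"
      by (simp add: F_subst)
  next
    fix \<sigma> \<Delta> x
    assume "deriv S \<Delta> (fsubst (case_nat x \<sigma>) (F (Var 0) (tsubst shift t)))"
    then have "deriv S \<Delta> (F x (tsubst \<sigma> t))" by (simp add: F_subst)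
    then have "deriv S \<Delta> (F (Succ x) (tsubst \<sigma> t))"
      unfolding F_def[of x]
    proof (rule Exists_elim)
      fix \<tau> \<Theta> z
      let ?x = "tsubst \<tau> x" and ?t = "tsubst \<tau> (tsubst \<sigma> t)"
      assume 1: "ext \<tau> \<Delta> \<Theta>" and "deriv S \<Theta> (fsubst (case_nat z \<tau>) (Conj
          (graph_fm diff [Succ (tsubst shift x), Succ (tsubst shift (tsubst \<sigma> t))] (Var 0))
          (graph_fm diff [tsubst shift x, tsubst shift (tsubst \<sigma> t)] (Var 0))))"
      then have z: "deriv S \<Theta> (Conj (graph_fm diff [Succ ?x, Succ ?t] z) (graph_fm diff [?x, ?t] z))"
        by simp
      have "deriv S \<Theta> (F (Succ ?x) ?t)"
      \<comment> \<open>One step further, both differences are the predecessor of the common value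
        \<open>z\<close>.\<close>
      proof (rule value_elim[where f = pred and ts = "[z]"])
        fix \<upsilon> \<Xi> w
        assume "ext \<upsilon> \<Theta> \<Xi>" and w: "deriv S \<Xi> (graph_fm pred (map (tsubst \<upsilon>) [z]) w)"
        from deriv_ext[OF z this(1)] w
        have "deriv S \<Xi> (F (Succ (tsubst \<upsilon> ?x)) (tsubst \<upsilon> ?t))"
          by (auto intro!: F_intro[where u = w] elim!: graph_diff_Succ[rotated]
              dest: deriv.AndE1 deriv.AndE2)
        then show "deriv S \<Xi> (fsubst \<upsilon> (F (Succ ?x) ?t))" by (simp add: F_subst)
      qed (use 1 ext_wf in auto)
      then show "deriv S \<Theta> (fsubst \<tau> (F (Succ x) (tsubst \<sigma> t)))" by (simp add: F_subst)
    qed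
    then show "deriv S \<Delta> (fsubst (case_nat (Succ x) \<sigma>) (F (Var 0) (tsubst shift t)))"
      by (simp add: F_subst)
  qed
  then show ?thesis by (simp add: F_subst) (simp add: F_def)
qed

lemma graph_neq:
  assumes "deriv S \<Gamma> (graph_fm diff [s, t] u)" "deriv S \<Gamma> (graph_fm neq1 [u] v)"
  shows "deriv S \<Gamma> (graph_fm neq [s, t] v)"
  unfolding neq_def using assms by (auto intro!: graph_Comp[where us = "[u]"])

text \<open>\<open>neq\<close> depends on its arguments only through \<open>diff\<close>, which has
  a common value at the two pairs.\<close>

lemma graph_neq_Succ_Succ:
  assumes "deriv S \<Gamma> (graph_fm neq [s, t] v)"
  shows "deriv S \<Gamma> (graph_fm neq [Succ s, Succ t] v)"
proof -
  have "wf_ctx \<Gamma>" using graph_fm_wf[OF assms] by simp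
  from diff_Succ_Succ[OF this, of S s t] show ?thesis
  proof (rule Exists_elim)
    fix \<sigma> \<Delta> z
    let ?s = "tsubst \<sigma> s" and ?t = "tsubst \<sigma> t" and ?v = "tsubst \<sigma> v"
    assume 1: "ext \<sigma> \<Gamma> \<Delta>" and "deriv S \<Delta> (fsubst (case_nat z \<sigma>) (Conj
        (graph_fm diff [Succ (tsubst shift s), Succ (tsubst shift t)] (Var 0))
        (graph_fm diff [tsubst shift s, tsubst shift t] (Var 0))))"
    then have z: "deriv S \<Delta> (Conj (graph_fm diff [Succ ?s, Succ ?t] z) (graph_fm diff [?s, ?t] z))"
      by simp
    have v: "deriv S \<Delta> (graph_fm neq [?s, ?t] ?v)" using deriv_ext[OF assms 1] by simp
    have "deriv S \<Delta> (graph_fm neq [Succ ?s, Succ ?t] ?v)"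
    proof (rule value_elim[where f = neq1 and ts = "[z]"])
      fix \<upsilon> \<Xi> w
      let ?s' = "tsubst \<upsilon> ?s" and ?t' = "tsubst \<upsilon> ?t" and ?z = "tsubst \<upsilon> z"
      assume 2: "ext \<upsilon> \<Delta> \<Xi>" and w: "deriv S \<Xi> (graph_fm neq1 (map (tsubst \<upsilon>) [z]) w)"
      have z': "deriv S \<Xi> (graph_fm diff [Succ ?s', Succ ?t'] ?z)" "deriv S \<Xi> (graph_fm diff [?s', ?t'] ?z)"
        using deriv_ext[OF z 2] by (auto dest: deriv.AndE1 deriv.AndE2)
      \<comment> \<open>\<open>w\<close> is computed from the common difference and \<open>v\<close>
        is the given value; functionality identifies them.\<close>
      have "deriv S \<Xi> (Atom (eq_atom w (tsubst \<upsilon> ?v)))"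
        using graph_functional[OF graph_neq[OF z'(2)]] w deriv_ext[OF v 2] by simp
      moreover have "deriv S \<Xi> (graph_fm neq [Succ ?s', Succ ?t'] w)"
        using graph_neq[OF z'(1)] w by simp
      ultimately have "deriv S \<Xi> (graph_fm neq [Succ ?s', Succ ?t'] (tsubst \<upsilon> ?v))"
        by (rule graph_replace)
      then show "deriv S \<Xi> (fsubst \<upsilon> (graph_fm neq [Succ ?s, Succ ?t] ?v))" by simp
    qed (use 1 ext_wf in auto)
    then show "deriv S \<Delta> (fsubst \<sigma> (graph_fm neq [Succ s, Succ t] v))" by simp
  qed
qed

section \<open>Decidability of equality\<close>

text \<open>The negative side is the complementary atom and not an implication, so that Post rules
  apply to it.\<close>

definition dec_atom :: "prfun \<Rightarrow> atom \<Rightarrow> fm" where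
  "dec_atom f P = (case P of Atm p ts \<Rightarrow> dec_fm f ts (Atom P) (Atom (compl P)))"

lemma fsubst_dec_atom [simp]: "fsubst \<sigma> (dec_atom f P) = dec_atom f (asubst \<sigma> P)"
  by (cases P) (simp add: dec_atom_def)

lemma neq_Succ_Zero: "wf_ctx \<Gamma> \<Longrightarrow> deriv S \<Gamma> (Atom (compl (eq_atom Zero (Succ t))))"
  using deriv_post[OF post.contrapos[of "[]" _ "[]", simplified, OF post.succ_not_zero], of S \<Gamma> t]
    deriv_post[OF post.bool_true, of S \<Gamma>] by simp

lemma eq_refl: "wf_ctx \<Gamma> \<Longrightarrow> deriv S \<Gamma> (Atom (eq_atom t t))"
  by (rule deriv_post[OF post.eq_refl]) auto

text \<open>Replacement of the left \<open>s\<close> in \<open>s = s\<close>. Reflexivity stays as a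
  second premise because \<open>contrapos\<close> will be applied to a single Post rule.\<close>

lemma post_eq_sym: "post [eq_atom s t, eq_atom s s] (eq_atom t s)"
  using post.eq_repl[of s t "eq_atom (Var 0) (tsubst shift s)"] by simp

text \<open>The induction on \<open>s\<close> keeps the other argument universally quantified, since
  the successor case uses the hypothesis at the predecessor of that argument; for the argument
  itself a case distinction suffices.\<close>

lemma dec_eq:
  assumes "wf_ctx \<Gamma>"
  shows "deriv S \<Gamma> (dec_atom neq (eq_atom s t))"
proof -
  let ?F = "\<lambda>s t. dec_atom neq (eq_atom s t)"
  have "deriv S \<Gamma> (fsubst (inst s) (Forall (?F (Var 1) (Var 0))))"
  proof (rule nat_induction)
    show "deriv S \<Gamma> (fsubst (inst Zero) (Forall (?F (Var 1) (Var 0))))"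
      unfolding fsubst.simps
    proof (rule Forall_intro[OF assms])
      fix \<sigma> \<Delta> y
      assume "ext \<sigma> \<Gamma> \<Delta>"
      then have wf: "wf_ctx \<Delta>" by (rule ext_wf)
      have "deriv S \<Delta> (fsubst (inst y) (?F Zero (Var 0)))"
      proof (rule nat_cases)
        have "deriv S \<Delta> (graph_fm neq [Zero, Zero] Zero)"
          using wf by (intro graph_neq[OF graph_diff_Zero] graph_neq1_Succ_Zero)
        moreover have "deriv S \<Delta> (Atom (eq_atom Zero Zero))"
          using wf by (rule eq_refl)
        ultimately show "deriv S \<Delta> (fsubst (inst Zero) (?F Zero (Var 0)))"
          by (simp add: dec_atom_def dec_intro1)
      next
        fix \<tau> \<Theta> x
        assume "ext \<tau> \<Delta> \<Theta>"
        then have wf: "wf_ctx \<Theta>" by (rule ext_wf)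
        have "deriv S \<Theta> (graph_fm neq [Zero, Succ x] (Succ Zero))"
          using wf by (intro graph_neq[OF graph_diff_Zero] graph_neq1_Succ_Succ)
        with neq_Succ_Zero[OF wf, of S x]
        show "deriv S \<Theta> (fsubst (case_nat (Succ x) \<tau>) (?F Zero (Var 0)))"
          by (simp add: dec_atom_def dec_intro2)
      qed
      then show "deriv S \<Delta> (fsubst (case_nat y \<sigma>) (fsubst (up (inst Zero)) (?F (Var 1) (Var 0))))"
        by simp
    qed
  next
    fix \<sigma> \<Delta> x
    assume IH: "ext \<sigma> \<Gamma> \<Delta>" "deriv S \<Delta> (fsubst (case_nat x \<sigma>) (Forall (?F (Var 1) (Var 0))))"
    show "deriv S \<Delta> (fsubst (case_nat (Succ x) \<sigma>) (Forall (?F (Var 1) (Var 0))))"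
      unfolding fsubst.simps
    proof (rule Forall_intro)
      show "wf_ctx \<Delta>" using IH(1) by (rule ext_wf)
    next
      fix \<tau> \<Theta> y
      let ?x = "tsubst \<tau> x"
      assume ext: "ext \<tau> \<Delta> \<Theta>"
      then have wf: "wf_ctx \<Theta>" by (rule ext_wf)
      have IH': "deriv S \<Theta> (Forall (?F (tsubst shift ?x) (Var 0)))"
        using deriv_ext[OF IH(2) ext] by (simp add: tsubst_up_shift)
      have "deriv S \<Theta> (fsubst (inst y) (?F (tsubst shift (Succ ?x)) (Var 0)))"
      proof (rule nat_cases)
        have "deriv S \<Theta> (graph_fm neq [Succ ?x, Zero] (Succ Zero))"
          using wf by (intro graph_neq[OF graph_diff_Succ_Zero] graph_neq1_Zero)
        moreover have "deriv S \<Theta> (Atom (compl (eq_atom (Succ ?x) Zero)))"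
        proof (rule deriv_post)
          \<comment> \<open>The contrapositive of symmetry, with reflexivity as side
            premise.\<close>
          show "post [compl (eq_atom Zero (Succ ?x)), eq_atom (Succ ?x) (Succ ?x)]
              (compl (eq_atom (Succ ?x) Zero))"
            using post.contrapos[of "[]" _ "[_]", simplified, OF post_eq_sym] by simp
        qed (use wf neq_Succ_Zero eq_refl in auto)
        ultimately show "deriv S \<Theta> (fsubst (inst Zero) (?F (tsubst shift (Succ ?x)) (Var 0)))"
          by (simp add: dec_atom_def dec_intro2)
      next
        fix \<upsilon> \<Xi> z
        let ?x' = "tsubst \<upsilon> ?x"
        assume "ext \<upsilon> \<Theta> \<Xi>"
        from deriv.AllE[OF deriv_ext[OF IH' this, unfolded fsubst.simps], of z]
        have "deriv S \<Xi> (dec_fm neq [?x', z] (Atom (eq_atom ?x' z)) (Atom (compl (eq_atom ?x' z))))"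
          by (simp add: dec_atom_def tsubst_up_shift)
        then have "deriv S \<Xi> (?F (Succ ?x') (Succ z))"
        proof (rule dec_elim)
          fix \<Psi>
          assume *: "deriv S \<Psi> (graph_fm neq [?x', z] Zero)" "deriv S \<Psi> (Atom (eq_atom ?x' z))"
          have "deriv S \<Psi> (Atom (eq_atom (Succ ?x') (Succ z)))"
          proof (rule deriv_post)
            show "post [eq_atom ?x' z, eq_atom (Succ ?x') (Succ ?x')] (eq_atom (Succ ?x') (Succ z))"
              using post.eq_repl[of ?x' z "eq_atom (Succ (tsubst shift ?x')) (Succ (Var 0))"] by simp
          qed (use * deriv_wf eq_refl in auto)
          then show "deriv S \<Psi> (?F (Succ ?x') (Succ z))"
            using graph_neq_Succ_Succ[OF *(1)] by (simp add: dec_atom_def dec_intro1)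
        next
          fix \<Psi>
          assume *: "deriv S \<Psi> (graph_fm neq [?x', z] (Succ Zero))"
            "deriv S \<Psi> (Atom (compl (eq_atom ?x' z)))"
          have "deriv S \<Psi> (Atom (compl (eq_atom (Succ ?x') (Succ z))))"
          proof (rule deriv_post)
            show "post [compl (eq_atom ?x' z)] (compl (eq_atom (Succ ?x') (Succ z)))"
              using post.contrapos[of "[]" _ "[]", simplified, OF post.succ_inj] by simp
          qed (use * deriv_wf in auto)
          then show "deriv S \<Psi> (?F (Succ ?x') (Succ z))"
            using graph_neq_Succ_Succ[OF *(1)] by (simp add: dec_atom_def dec_intro2)
        qed
        then show "deriv S \<Xi> (fsubst (case_nat (Succ z) \<upsilon>) (?F (tsubst shift (Succ ?x)) (Var 0)))"
          by simp
      qed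
      then show "deriv S \<Theta> (fsubst (case_nat y \<tau>) (fsubst (up (case_nat (Succ x) \<sigma>)) (?F (Var 1) (Var 0))))"
        by simp
    qed
  qed
  from deriv.AllE[OF this[unfolded fsubst.simps], of t] show ?thesis by simp
qed


section \<open>Characteristic functions of the predicate symbols\<close>

text \<open>The value 0 means true and exactly 1 means false, so \<open>sg\<close> has to normalise
  the value for \<open>Zeros\<close>. For a graph, the projections discard the last argument before
  \<open>f\<close> is applied.\<close>

fun rel_char :: "rel \<Rightarrow> prfun" where
  "rel_char Eq = neq"
| "rel_char (Graph f) = (let n = pr_arity f in
     Comp (Suc n) neq [Comp (Suc n) f (map (Proj (Suc n)) [0..<n]), Proj (Suc n) n])"
| "rel_char (Zeros f) = Comp (pr_arity f) sg [f]"

text \<open>Name the value \<open>u\<close> of \<open>f\<close> and decide whether it equals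
  \<open>t\<close>: equality gives the graph atom by replacement, inequality gives its complement by
  the contrapositive of functionality.\<close>

lemma dec_rel_Graph:
  assumes wf: "wf_prfun f" "length ts = pr_arity f" "wf_ctx \<Gamma>"
  shows "deriv S \<Gamma> (dec_atom (rel_char (Graph f)) (graph_atom f ts t))"
proof (rule value_elim[OF wf])
  fix \<sigma> \<Delta> u
  let ?n = "pr_arity f" and ?ts = "map (tsubst \<sigma>) ts" and ?t = "tsubst \<sigma> t"
  assume "ext \<sigma> \<Gamma> \<Delta>" and u: "deriv S \<Delta> (graph_fm f ?ts u)"
  then have wf_ctx: "wf_ctx \<Delta>" by (simp add: ext_wf)
  have char: "deriv S \<Theta> (graph_fm (rel_char (Graph f)) (?ts @ [?t]) v)"
    if "\<Delta> \<sqsubseteq> \<Theta>" "deriv S \<Theta> (graph_fm neq [u, ?t] v)" for \<Theta> v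
  proof -
    have "wf_ctx \<Theta>" using that by (simp add: ext_wf)
    then have "list_all2 (\<lambda>g u. deriv S \<Theta> (graph_fm g (?ts @ [?t]) u)) (map (Proj (Suc ?n)) [0..<?n]) ?ts"
      using wf by (auto simp: list_all2_conv_all_nth nth_append intro!: graph_Proj)
    then have "deriv S \<Theta> (graph_fm (Comp (Suc ?n) f (map (Proj (Suc ?n)) [0..<?n])) (?ts @ [?t]) u)"
      using wf weaken[OF u that(1)] by (auto intro: graph_Comp)
    with that wf \<open>wf_ctx \<Theta>\<close> show ?thesis
      by (auto simp: Let_def nth_append intro!: graph_Comp[where us = "[u, ?t]"] graph_Proj)
  qed
  have "deriv S \<Delta> (dec_fm neq [u, ?t] (Atom (eq_atom u ?t)) (Atom (compl (eq_atom u ?t))))"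
    using dec_eq[OF wf_ctx, of S u ?t] by (simp add: dec_atom_def)
  then have "deriv S \<Delta> (dec_atom (rel_char (Graph f)) (graph_atom f ?ts ?t))"
  proof (rule dec_elim)
    fix \<Theta> assume *: "\<Delta> \<sqsubseteq> \<Theta>" "deriv S \<Theta> (graph_fm neq [u, ?t] Zero)" "deriv S \<Theta> (Atom (eq_atom u ?t))"
    from graph_replace[OF *(3) weaken[OF u *(1)]]
    have "deriv S \<Theta> (Atom (graph_atom f ?ts ?t))" by (simp add: graph_fm_def)
    with char[OF *(1,2)] wf show "deriv S \<Theta> (dec_atom (rel_char (Graph f)) (graph_atom f ?ts ?t))"
      by (simp add: dec_atom_def dec_intro1)
  next
    fix \<Theta> assume *: "\<Delta> \<sqsubseteq> \<Theta>" "deriv S \<Theta> (graph_fm neq [u, ?t] (Succ Zero))"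
      "deriv S \<Theta> (Atom (compl (eq_atom u ?t)))"
    have "deriv S \<Theta> (Atom (compl (graph_atom f ?ts ?t)))"
    proof (rule deriv_post)
      show "post [graph_atom f ?ts u, compl (eq_atom u ?t)] (compl (graph_atom f ?ts ?t))"
        using post.contrapos[of "[_]" _ "[]", simplified, OF post.graph_functional[of f ?ts u ?t]]
        by simp
    qed (use * weaken[OF u *(1)] ext_wf wf in \<open>auto simp: graph_fm_def\<close>)
    with char[OF *(1,2)] wf show "deriv S \<Theta> (dec_atom (rel_char (Graph f)) (graph_atom f ?ts ?t))"
      by (simp add: dec_atom_def dec_intro2)
  qed
  then show "deriv S \<Delta> (fsubst \<sigma> (dec_atom (rel_char (Graph f)) (graph_atom f ts t)))" by simp
qed

lemma dec_rel_Zeros: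
  assumes wf: "wf_prfun f" "length ts = pr_arity f" "wf_ctx \<Gamma>"
  shows "deriv S \<Gamma> (dec_atom (rel_char (Zeros f)) (zeros_atom f ts))"
proof -
  \<comment> \<open>The case distinction on the value must also change the hypothesis that
    \<open>f\<close> has this value, so the hypothesis is made part of the formula.\<close>
  let ?F = "\<lambda>t ts. Impl (graph_fm f ts t) (dec_atom (rel_char (Zeros f)) (zeros_atom f ts))"
  have sg: "deriv S \<Delta> (graph_fm (rel_char (Zeros f)) us v)"
    if "deriv S \<Delta> (graph_fm f us u)" "deriv S \<Delta> (graph_fm sg [u] v)" for \<Delta> us u v
    using that graph_fm_wf[OF that(1)] by (auto intro!: graph_Comp[where us = "[u]"])
  have Zero: "deriv S \<Delta> (?F Zero us)" if "wf_ctx \<Delta>" "length us = pr_arity f" for \<Delta> us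
  proof (rule Impl_intro)
    fix \<Theta> assume *: "\<Delta> \<sqsubseteq> \<Theta>" "deriv S \<Theta> (graph_fm f us Zero)"
    have "deriv S \<Theta> (Atom (zeros_atom f us))"
      by (rule deriv_post[OF post.zeros_pos]) (use * wf that ext_wf in \<open>auto simp: graph_fm_def\<close>)
    with sg[OF *(2)] wf that * show "deriv S \<Theta> (dec_atom (rel_char (Zeros f)) (zeros_atom f us))"
      by (simp add: dec_atom_def dec_intro1 ext_wf graph_sg_Zero del: rel_char.simps)
  qed (use that wf in auto)
  have Succ: "deriv S \<Delta> (?F (Succ t) us)" if "wf_ctx \<Delta>" "length us = pr_arity f" for \<Delta> us t
  proof (rule Impl_intro)
    fix \<Theta> assume *: "\<Delta> \<sqsubseteq> \<Theta>" "deriv S \<Theta> (graph_fm f us (Succ t))"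
    have "deriv S \<Theta> (Atom (compl (zeros_atom f us)))"
      by (rule deriv_post[OF post.zeros_neg[of f us t]])
        (use * wf that ext_wf in \<open>auto simp: graph_fm_def\<close>)
    with sg[OF *(2)] wf that * show "deriv S \<Theta> (dec_atom (rel_char (Zeros f)) (zeros_atom f us))"
      by (simp add: dec_atom_def dec_intro2 ext_wf graph_sg_Succ del: rel_char.simps)
  qed (use that wf in auto)
  show ?thesis
  proof (rule value_elim[OF wf])
    fix \<sigma> \<Delta> u
    let ?ts = "map (tsubst \<sigma>) ts"
    assume *: "ext \<sigma> \<Gamma> \<Delta>" "deriv S \<Delta> (graph_fm f ?ts u)"
    have "deriv S \<Delta> (fsubst (inst u) (?F (Var 0) (map (tsubst shift) ?ts)))"
    proof (rule nat_cases)
      show "deriv S \<Delta> (fsubst (inst Zero) (?F (Var 0) (map (tsubst shift) ?ts)))"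
        using Zero[of \<Delta> ?ts] * wf by (simp add: ext_wf del: rel_char.simps)
    next
      fix \<tau> \<Theta> x assume "ext \<tau> \<Delta> \<Theta>"
      with Succ[of \<Theta> "map (tsubst \<tau>) ?ts"] wf
      show "deriv S \<Theta> (fsubst (case_nat (Succ x) \<tau>) (?F (Var 0) (map (tsubst shift) ?ts)))"
        by (simp add: ext_wf del: rel_char.simps)
    qed
    then have "deriv S \<Delta> (?F u ?ts)" by (simp del: rel_char.simps)
    from deriv.ImpE[OF this *(2)]
    show "deriv S \<Delta> (fsubst \<sigma> (dec_atom (rel_char (Zeros f)) (zeros_atom f ts)))"
      by (simp del: rel_char.simps)
  qed
qed

lemma dec_rel:
  assumes "wf_rel R" "length ts = rel_arity R" "wf_ctx \<Gamma>"
  shows "deriv S \<Gamma> (dec_atom (rel_char R) (Atm (Pos R) ts))"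
proof (cases R)
  case Eq
  with assms(2) obtain s t where "ts = [s, t]"
    by (auto simp: length_Suc_conv numeral_2_eq_2)
  with Eq dec_eq[OF assms(3)] show ?thesis by simp
next
  case (Graph f)
  with assms(2) obtain us t where "ts = us @ [t]" "length us = pr_arity f"
    by (cases ts rule: rev_cases) auto
  with Graph dec_rel_Graph[of f us \<Gamma> S t] assms show ?thesis by simp
next
  case (Zeros f)
  with dec_rel_Zeros[of f ts \<Gamma> S] assms show ?thesis by simp
qed

section \<open>Negative propositional formulas are equivalent to atoms\<close>

text \<open>With 0 for true, each of the three connectives is a case distinction on its first
  argument, written as a recursion whose step ignores the previous value.\<close>

definition not_fun :: prfun where
  "not_fun = Rec (const1 0) (const0 2)"

definition conj_fun :: prfun where
  "conj_fun = Rec (Proj 1 0) (const1 3)"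

definition impl_fun :: prfun where
  "impl_fun = Rec (Proj 1 0) (const0 3)"

lemma bool_simps [simp]:
  "wf_prfun not_fun" "pr_arity not_fun = 1"
  "wf_prfun conj_fun" "pr_arity conj_fun = 2"
  "wf_prfun impl_fun" "pr_arity impl_fun = 2"
  by (simp_all add: not_fun_def conj_fun_def impl_fun_def)

lemma graph_not_fun:
  "wf_ctx \<Gamma> \<Longrightarrow> deriv S \<Gamma> (graph_fm not_fun [Zero] (Succ Zero))"
  "wf_ctx \<Gamma> \<Longrightarrow> deriv S \<Gamma> (graph_fm not_fun [Succ t] Zero)"
  unfolding not_fun_def
  by (auto intro!: graph_Rec_Succ_const graph_Rec_Zero graph_const0 graph_const1 simp: ext_wf)

lemma graph_conj_fun:
  "wf_ctx \<Gamma> \<Longrightarrow> deriv S \<Gamma> (graph_fm conj_fun [Zero, t] t)"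
  "wf_ctx \<Gamma> \<Longrightarrow> deriv S \<Gamma> (graph_fm conj_fun [Succ s, t] (Succ Zero))"
  unfolding conj_fun_def
  by (auto intro!: graph_Rec_Succ_const graph_Rec_Zero graph_const1 graph_Proj simp: ext_wf)

lemma graph_impl_fun:
  "wf_ctx \<Gamma> \<Longrightarrow> deriv S \<Gamma> (graph_fm impl_fun [Zero, t] t)"
  "wf_ctx \<Gamma> \<Longrightarrow> deriv S \<Gamma> (graph_fm impl_fun [Succ s, t] Zero)"
  unfolding impl_fun_def
  by (auto intro!: graph_Rec_Succ_const graph_Rec_Zero graph_const0 graph_Proj simp: ext_wf)

fun sym_char :: "sym \<Rightarrow> prfun" where
  "sym_char (Pos R) = rel_char R"
| "sym_char (Neg R) = Comp (rel_arity R) not_fun [rel_char R]"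

lemma deriv_dec_atom:
  assumes "wf_atom (Atm p ts)" "wf_ctx \<Gamma>"
  shows "deriv S \<Gamma> (dec_atom (sym_char p) (Atm p ts))"
proof (cases p)
  case (Pos R)
  with dec_rel assms show ?thesis by simp
next
  case (Neg R)
  \<comment> \<open>For a complemented symbol the two alternatives for \<open>R\<close> trade
    places, and \<open>not_fun\<close> exchanges the values accordingly.\<close>
  have "deriv S \<Gamma> (dec_fm (rel_char R) ts (Atom (Atm (Pos R) ts)) (Atom (Atm (Neg R) ts)))"
    using dec_rel[of R ts \<Gamma> S] assms Neg by (simp add: dec_atom_def)
  then show ?thesis
  proof (rule dec_elim)
    fix \<Delta> assume *: "\<Gamma> \<sqsubseteq> \<Delta>" "deriv S \<Delta> (graph_fm (rel_char R) ts Zero)" "deriv S \<Delta> (Atom (Atm (Pos R) ts))"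
    have "deriv S \<Delta> (graph_fm (sym_char p) ts (Succ Zero))"
      using * assms Neg graph_not_fun
      by (auto intro!: graph_Comp[where us = "[Zero]"] simp: ext_wf)
    with * assms Neg show "deriv S \<Delta> (dec_atom (sym_char p) (Atm p ts))"
      by (simp add: dec_atom_def dec_intro2)
  next
    fix \<Delta> assume *: "\<Gamma> \<sqsubseteq> \<Delta>" "deriv S \<Delta> (graph_fm (rel_char R) ts (Succ Zero))"
      "deriv S \<Delta> (Atom (Atm (Neg R) ts))"
    have "deriv S \<Delta> (graph_fm (sym_char p) ts Zero)"
      using * assms Neg graph_not_fun
      by (auto intro!: graph_Comp[where us = "[Succ Zero]"] simp: ext_wf)
    with * assms Neg show "deriv S \<Delta> (dec_atom (sym_char p) (Atm p ts))"
      by (simp add: dec_atom_def dec_intro1)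
  qed
qed

lemma dec_atom_elim:
  assumes "wf_atom P" "wf_ctx \<Gamma>"
    and "\<And>\<Delta>. \<Gamma> \<sqsubseteq> \<Delta> \<Longrightarrow> deriv S \<Delta> (Atom P) \<Longrightarrow> deriv S \<Delta> C"
    and "\<And>\<Delta>. \<Gamma> \<sqsubseteq> \<Delta> \<Longrightarrow> deriv S \<Delta> (Atom (compl P)) \<Longrightarrow> deriv S \<Delta> C"
  shows "deriv S \<Gamma> C"
proof (cases P)
  case (Atm p ts)
  from deriv_dec_atom[OF assms(1,2)[unfolded Atm], of S, unfolded dec_atom_def] assms(3,4) Atm
  show ?thesis by (auto elim: dec_elim)
qed

lemma compl_contradiction:
  assumes "deriv S \<Gamma> (Atom P)" "deriv S \<Gamma> (Atom (compl P))"
  shows "deriv S \<Gamma> Falsum"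
proof (rule deriv_post[of "[P, compl P]"])
  \<comment> \<open>No valuation that respects \<open>compl\<close> satisfies both premises, so the
    tautology condition holds vacuously.\<close>
  show "post [P, compl P] bot_atom" by (rule post.tautology) auto
qed (use assms deriv_wf in auto)


section \<open>Terms and formulas as functions of their variables\<close>

fun tm_bound :: "tm \<Rightarrow> nat" where
  "tm_bound (Var i) = Suc i"
| "tm_bound Zero = 0"
| "tm_bound (Succ t) = tm_bound t"

text \<open>The atom that will replace a formula has just a list of variables as arguments, so the
  terms of the formula are absorbed into its characteristic function.\<close>

fun tm_fun :: "nat \<Rightarrow> tm \<Rightarrow> prfun" where
  "tm_fun n (Var i) = Proj n i"
| "tm_fun n Zero = const0 n"
| "tm_fun n (Succ t) = Comp n PSucc [tm_fun n t]"

lemma graph_tm_fun: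
  "wf_ctx \<Gamma> \<Longrightarrow> tm_bound t \<le> n \<Longrightarrow> deriv S \<Gamma> (graph_fm (tm_fun n t) (map Var [0..<n]) t)"
  by (induction t) (auto intro!: graph_Proj graph_const0 graph_PSucc graph_Comp)

text \<open>A bound on the variables of quantifier-free formulas only; 0 is a junk value.\<close>

fun fm_bound :: "fm \<Rightarrow> nat" where
  "fm_bound (Atom (Atm p ts)) = sum_list (map tm_bound ts)"
| "fm_bound (Conj A B) = fm_bound A + fm_bound B"
| "fm_bound (Disj A B) = fm_bound A + fm_bound B"
| "fm_bound (Impl A B) = fm_bound A + fm_bound B"
| "fm_bound (Forall A) = 0"
| "fm_bound (Exists A) = 0"

text \<open>The value 0 stands for true. The last case is a junk value.\<close>

fun fm_char :: "nat \<Rightarrow> fm \<Rightarrow> prfun" where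
  "fm_char n (Atom (Atm p ts)) = Comp n (sym_char p) (map (tm_fun n) ts)"
| "fm_char n (Conj A B) = Comp n conj_fun [fm_char n A, fm_char n B]"
| "fm_char n (Impl A B) = Comp n impl_fun [fm_char n A, fm_char n B]"
| "fm_char n _ = PZero"

text \<open>The number \<open>n\<close> is a common upper bound and not the bound of the formula
  itself, so that all subformulas are evaluated at the same list of variables.\<close>

lemma dec_fm_char:
  assumes "negative_propositional A" "wf_fm A" "fm_bound A \<le> n" "wf_ctx \<Gamma>"
  shows "deriv S \<Gamma> (dec_fm (fm_char n A) (map Var [0..<n]) A (Neg_fm A))"
  using assms
proof (induction A arbitrary: \<Gamma>)
  case (Atom P)
  obtain p ts where P: "P = Atm p ts" by (cases P)
  have bound: "tm_bound t \<le> n" if "t \<in> set ts" for t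
    using member_le_sum_list[of "tm_bound t" "map tm_bound ts"] that Atom.prems(3) by (auto simp: P)
  have char: "deriv S \<Delta> (graph_fm (fm_char n (Atom P)) (map Var [0..<n]) u)"
    if "deriv S \<Delta> (graph_fm (sym_char p) ts u)" for \<Delta> u
    using that bound graph_fm_wf[OF that]
    by (auto simp: P list_all2_conv_all_nth intro!: graph_Comp graph_tm_fun)
  have "deriv S \<Gamma> (dec_fm (sym_char p) ts (Atom P) (Atom (compl P)))"
    using deriv_dec_atom[of p ts \<Gamma> S] Atom by (simp add: P dec_atom_def)
  then show ?case
  proof (rule dec_elim)
    fix \<Delta> assume "deriv S \<Delta> (graph_fm (sym_char p) ts Zero)" "deriv S \<Delta> (Atom P)"
    with char Atom show "deriv S \<Delta> (dec_fm (fm_char n (Atom P)) (map Var [0..<n]) (Atom P) (Neg_fm (Atom P)))"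
      by (intro dec_intro1) auto
  next
    fix \<Delta> assume *: "deriv S \<Delta> (graph_fm (sym_char p) ts (Succ Zero))" "deriv S \<Delta> (Atom (compl P))"
    have "deriv S \<Delta> (Neg_fm (Atom P))"
      using * Atom by (intro Impl_intro) (auto intro: compl_contradiction weaken dest: deriv_wf)
    with * char Atom show "deriv S \<Delta> (dec_fm (fm_char n (Atom P)) (map Var [0..<n]) (Atom P) (Neg_fm (Atom P)))"
      by (intro dec_intro2) auto
  qed
next
  case (Conj A B)
  let ?xs = "map Var [0..<n]"
  let ?goal = "dec_fm (fm_char n (Conj A B)) ?xs (Conj A B) (Neg_fm (Conj A B))"
  have neg: "negative_propositional A" "negative_propositional B"
    using Conj.prems by (auto simp: negative_propositional_def)
  have char: "deriv S \<Delta> (graph_fm (fm_char n (Conj A B)) ?xs w)"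
    if "deriv S \<Delta> (graph_fm (fm_char n A) ?xs u)" "deriv S \<Delta> (graph_fm (fm_char n B) ?xs v)"
      "deriv S \<Delta> (graph_fm conj_fun [u, v] w)" for \<Delta> u v w
    using that by (auto intro!: graph_Comp[where us = "[u, v]"])
  have "deriv S \<Gamma> (dec_fm (fm_char n A) ?xs A (Neg_fm A))" using Conj neg by auto
  then show ?case
  proof (rule dec_elim)
    fix \<Delta> assume A: "\<Gamma> \<sqsubseteq> \<Delta>" "deriv S \<Delta> (graph_fm (fm_char n A) ?xs Zero)" "deriv S \<Delta> A"
    then have "deriv S \<Delta> (dec_fm (fm_char n B) ?xs B (Neg_fm B))" using Conj neg by (auto simp: ext_wf)
    then show "deriv S \<Delta> ?goal"
    proof (rule dec_elim)
      fix \<Theta> assume B: "\<Delta> \<sqsubseteq> \<Theta>" "deriv S \<Theta> (graph_fm (fm_char n B) ?xs Zero)" "deriv S \<Theta> B"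
      have "deriv S \<Theta> (graph_fm (fm_char n (Conj A B)) ?xs Zero)"
        using A B by (intro char[OF weaken[OF A(2) B(1)] B(2)] graph_conj_fun) (simp add: ext_wf)
      then show "deriv S \<Theta> ?goal"
        using weaken[OF A(3) B(1)] B(3) Conj.prems by (intro dec_intro1) (auto intro: deriv.AndI)
    next
      fix \<Theta> assume B: "\<Delta> \<sqsubseteq> \<Theta>" "deriv S \<Theta> (graph_fm (fm_char n B) ?xs (Succ Zero))"
        "deriv S \<Theta> (Neg_fm B)"
      have "deriv S \<Theta> (graph_fm (fm_char n (Conj A B)) ?xs (Succ Zero))"
        using A B by (intro char[OF weaken[OF A(2) B(1)] B(2)] graph_conj_fun) (simp add: ext_wf)
      moreover have "deriv S \<Theta> (Neg_fm (Conj A B))"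
      proof (rule Impl_intro)
        fix \<Psi> assume "\<Theta> \<sqsubseteq> \<Psi>" "deriv S \<Psi> (Conj A B)"
        then show "deriv S \<Psi> Falsum"
          using deriv.ImpE[OF weaken[OF B(3)] deriv.AndE2] by blast
      qed (use B Conj.prems in \<open>auto simp: ext_wf\<close>)
      ultimately show "deriv S \<Theta> ?goal"
        using Conj.prems by (intro dec_intro2) auto
    qed
  next
    fix \<Delta> assume A: "\<Gamma> \<sqsubseteq> \<Delta>" "deriv S \<Delta> (graph_fm (fm_char n A) ?xs (Succ Zero))"
      "deriv S \<Delta> (Neg_fm A)"
    have neg_goal: "deriv S \<Delta> (Neg_fm (Conj A B))"
    proof (rule Impl_intro)
      fix \<Psi> assume "\<Delta> \<sqsubseteq> \<Psi>" "deriv S \<Psi> (Conj A B)"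
      then show "deriv S \<Psi> Falsum"
        using deriv.ImpE[OF weaken[OF A(3)] deriv.AndE1] by blast
    qed (use A Conj.prems in \<open>auto simp: ext_wf\<close>)
    \<comment> \<open>The truth of \<open>B\<close> no longer matters, but the composition still
      asks for some value of its characteristic function; either alternative for \<open>B\<close>
      provides one.\<close>
    have goal: "deriv S \<Theta> ?goal" if "\<Delta> \<sqsubseteq> \<Theta>" "deriv S \<Theta> (graph_fm (fm_char n B) ?xs v)" for \<Theta> v
    proof -
      have "deriv S \<Theta> (graph_fm (fm_char n (Conj A B)) ?xs (Succ Zero))"
        using that by (intro char[OF weaken[OF A(2)]] graph_conj_fun) (auto simp: ext_wf)
      then show ?thesis
        using weaken[OF neg_goal] that Conj.prems by (intro dec_intro2) auto
    qed
    have "deriv S \<Delta> (dec_fm (fm_char n B) ?xs B (Neg_fm B))" using A Conj neg by (auto simp: ext_wf)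
    then show "deriv S \<Delta> ?goal" by (rule dec_elim) (rule goal, assumption, assumption)+
  qed
next
  case (Impl A B)
  let ?xs = "map Var [0..<n]"
  let ?goal = "dec_fm (fm_char n (Impl A B)) ?xs (Impl A B) (Neg_fm (Impl A B))"
  have neg: "negative_propositional A" "negative_propositional B"
    using Impl.prems by (auto simp: negative_propositional_def)
  have char: "deriv S \<Delta> (graph_fm (fm_char n (Impl A B)) ?xs w)"
    if "deriv S \<Delta> (graph_fm (fm_char n A) ?xs u)" "deriv S \<Delta> (graph_fm (fm_char n B) ?xs v)"
      "deriv S \<Delta> (graph_fm impl_fun [u, v] w)" for \<Delta> u v w
    using that by (auto intro!: graph_Comp[where us = "[u, v]"])
  have "deriv S \<Gamma> (dec_fm (fm_char n A) ?xs A (Neg_fm A))" using Impl neg by auto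
  then show ?case
  proof (rule dec_elim)
    fix \<Delta> assume A: "\<Gamma> \<sqsubseteq> \<Delta>" "deriv S \<Delta> (graph_fm (fm_char n A) ?xs Zero)" "deriv S \<Delta> A"
    then have "deriv S \<Delta> (dec_fm (fm_char n B) ?xs B (Neg_fm B))" using Impl neg by (auto simp: ext_wf)
    then show "deriv S \<Delta> ?goal"
    proof (rule dec_elim)
      fix \<Theta> assume B: "\<Delta> \<sqsubseteq> \<Theta>" "deriv S \<Theta> (graph_fm (fm_char n B) ?xs Zero)" "deriv S \<Theta> B"
      have "deriv S \<Theta> (graph_fm (fm_char n (Impl A B)) ?xs Zero)"
        using A B by (intro char[OF weaken[OF A(2) B(1)] B(2)] graph_impl_fun) (simp add: ext_wf)
      moreover have "deriv S \<Theta> (Impl A B)"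
        using B Impl.prems by (intro Impl_intro) (auto simp: ext_wf intro: weaken)
      ultimately show "deriv S \<Theta> ?goal"
        using Impl.prems by (intro dec_intro1) auto
    next
      fix \<Theta> assume B: "\<Delta> \<sqsubseteq> \<Theta>" "deriv S \<Theta> (graph_fm (fm_char n B) ?xs (Succ Zero))"
        "deriv S \<Theta> (Neg_fm B)"
      have "deriv S \<Theta> (graph_fm (fm_char n (Impl A B)) ?xs (Succ Zero))"
        using A B by (intro char[OF weaken[OF A(2) B(1)] B(2)] graph_impl_fun) (simp add: ext_wf)
      moreover have "deriv S \<Theta> (Neg_fm (Impl A B))"
      proof (rule Impl_intro)
        fix \<Psi> assume "\<Theta> \<sqsubseteq> \<Psi>" "deriv S \<Psi> (Impl A B)"
        then have "deriv S \<Psi> B" using deriv.ImpE weaken[OF weaken[OF A(3) B(1)]] by blast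
        with weaken[OF B(3) \<open>\<Theta> \<sqsubseteq> \<Psi>\<close>] show "deriv S \<Psi> Falsum" by (rule deriv.ImpE)
      qed (use B Impl.prems in \<open>auto simp: ext_wf\<close>)
      ultimately show "deriv S \<Theta> ?goal"
        using Impl.prems by (intro dec_intro2) auto
    qed
  next
    fix \<Delta> assume A: "\<Gamma> \<sqsubseteq> \<Delta>" "deriv S \<Delta> (graph_fm (fm_char n A) ?xs (Succ Zero))"
      "deriv S \<Delta> (Neg_fm A)"
    have impl: "deriv S \<Delta> (Impl A B)"
    proof (rule Impl_intro)
      fix \<Psi> assume "\<Delta> \<sqsubseteq> \<Psi>" "deriv S \<Psi> A"
      then have "deriv S \<Psi> Falsum" by (rule deriv.ImpE[OF weaken[OF A(3)]])
      then show "deriv S \<Psi> B" using Impl.prems by (simp add: Falsum_elim)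
    qed (use A Impl.prems in \<open>auto simp: ext_wf\<close>)
    \<comment> \<open>Again any value for \<open>B\<close> will do, since \<open>impl_fun\<close> is
      0 as soon as its first argument is a successor.\<close>
    have goal: "deriv S \<Theta> ?goal" if "\<Delta> \<sqsubseteq> \<Theta>" "deriv S \<Theta> (graph_fm (fm_char n B) ?xs v)" for \<Theta> v
    proof -
      have "deriv S \<Theta> (graph_fm (fm_char n (Impl A B)) ?xs Zero)"
        using that by (intro char[OF weaken[OF A(2)]] graph_impl_fun) (auto simp: ext_wf)
      then show ?thesis
        using weaken[OF impl] that Impl.prems by (intro dec_intro1) auto
    qed
    have "deriv S \<Delta> (dec_fm (fm_char n B) ?xs B (Neg_fm B))" using A Impl neg by (auto simp: ext_wf)
    then show "deriv S \<Delta> ?goal" by (rule dec_elim) (rule goal, assumption, assumption)+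
  qed
qed (simp_all add: negative_propositional_def)

text \<open>Both directions hold in every context, so they can be applied under an existential
  quantifier whose variable occurs in \<open>A\<close>.\<close>

lemma negative_propositional_atom:
  assumes "negative_propositional A" "wf_fm A"
  obtains P where "wf_atom P"
    and "\<And>\<Gamma>. deriv S \<Gamma> A \<Longrightarrow> deriv S \<Gamma> (Atom P)" "\<And>\<Gamma>. deriv S \<Gamma> (Atom P) \<Longrightarrow> deriv S \<Gamma> A"
proof -
  let ?n = "fm_bound A"
  let ?f = "fm_char ?n A" and ?xs = "map Var [0..<?n]"
  let ?P = "zeros_atom ?f ?xs"
  have dec: "deriv S \<Gamma> (dec_fm ?f ?xs A (Neg_fm A))" if "wf_ctx \<Gamma>" for \<Gamma>
    using dec_fm_char assms that by simp
  \<comment> \<open>Derivable formulas are well formed, so the arity is read off from a derivation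
    in the empty context.\<close>
  have wf: "wf_prfun ?f \<and> pr_arity ?f = ?n"
    using deriv_wf[OF dec[of "[]"]] by (simp add: dec_fm_def)
  show thesis
  proof (rule that[of ?P])
    show "wf_atom ?P" using wf by simp
  next
    fix \<Gamma> assume A: "deriv S \<Gamma> A"
    then have "wf_ctx \<Gamma>" using deriv_wf by blast
    from dec[OF this] show "deriv S \<Gamma> (Atom ?P)"
    proof (rule dec_elim)
      fix \<Delta> assume "\<Gamma> \<sqsubseteq> \<Delta>" "deriv S \<Delta> (graph_fm ?f ?xs Zero)"
      then show "deriv S \<Delta> (Atom ?P)"
        using wf by (intro deriv_post[OF post.zeros_pos]) (auto simp: graph_fm_def ext_wf)
    next
      fix \<Delta> assume *: "\<Gamma> \<sqsubseteq> \<Delta>" "deriv S \<Delta> (Neg_fm A)"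
      from *(2) weaken[OF A *(1)] have "deriv S \<Delta> Falsum" by (rule deriv.ImpE)
      then show "deriv S \<Delta> (Atom ?P)" using wf by (simp add: Falsum_elim)
    qed
  next
    fix \<Gamma> assume P: "deriv S \<Gamma> (Atom ?P)"
    then have "wf_ctx \<Gamma>" using deriv_wf by blast
    from dec[OF this] show "deriv S \<Gamma> A"
    proof (rule dec_elim)
      fix \<Delta> assume *: "\<Gamma> \<sqsubseteq> \<Delta>" "deriv S \<Delta> (graph_fm ?f ?xs (Succ Zero))"
      then have "deriv S \<Delta> (Atom (compl ?P))"
        using wf by (intro deriv_post[OF post.zeros_neg]) (auto simp: graph_fm_def ext_wf)
      with weaken[OF P *(1)] have "deriv S \<Delta> Falsum" by (rule compl_contradiction)
      then show "deriv S \<Delta> A" using assms by (simp add: Falsum_elim)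
    qed
  qed
qed

section \<open>Markov's principle and excluded middle\<close>

text \<open>In the rule for \<open>compl P\<close>, the universal premise contradicts the double
  negation, and in the existential premise a refuted complement gives \<open>P\<close> by
  decidability.\<close>

lemma Markov_from_EM1_minus:
  assumes "wf_atom P" "wf_ctx \<Gamma>"
  shows "deriv HA_EM1_minus \<Gamma> (Impl (Neg_fm (Neg_fm (Exists (Atom P)))) (Exists (Atom P)))"
proof (rule Impl_intro)
  fix \<Delta>
  let ?deriv = "deriv HA_EM1_minus"
  assume \<Delta>: "\<Gamma> \<sqsubseteq> \<Delta>" "?deriv \<Delta> (Neg_fm (Neg_fm (Exists (Atom P))))"
  then have wf: "wf_ctx \<Delta>" by (simp add: ext_wf)
  show "?deriv \<Delta> (Exists (Atom P))"
  proof (rule deriv.EM1_minus)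
    show "negative_propositional (Atom P)" by (simp add: negative_propositional_def)
  next
    let ?\<Delta> = "Forall (Atom (compl P)) # \<Delta>"
    have wf': "wf_ctx ?\<Delta>" using wf assms by simp
    have all: "?deriv ?\<Delta> (Forall (Atom (compl P)))" using wf assms by (simp add: deriv_hd)
    have "?deriv ?\<Delta> (Neg_fm (Exists (Atom P)))"
    proof (rule Impl_intro)
      fix \<Theta> assume \<Theta>: "?\<Delta> \<sqsubseteq> \<Theta>" "?deriv \<Theta> (Exists (Atom P))"
      from \<Theta>(2) show "?deriv \<Theta> Falsum"
      proof (rule Exists_elim)
        fix \<sigma> \<Xi> x
        assume \<Xi>: "ext \<sigma> \<Theta> \<Xi>" "?deriv \<Xi> (fsubst (case_nat x \<sigma>) (Atom P))"
        from deriv.AllE[OF deriv_ext[OF weaken[OF all \<Theta>(1)] \<Xi>(1), unfolded fsubst.simps], of x]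
        have "?deriv \<Xi> (Atom (compl (asubst (case_nat x \<sigma>) P)))" by simp
        with \<Xi>(2) show "?deriv \<Xi> (fsubst \<sigma> Falsum)" by (auto intro: compl_contradiction)
      qed
    qed (use wf' assms in auto)
    with weaken[OF \<Delta>(2) weak_Cons] wf assms have "?deriv ?\<Delta> Falsum"
      by (simp add: deriv.ImpE[of _ _ "Neg_fm (Exists (Atom P))"])
    then show "?deriv ?\<Delta> (Exists (Atom P))" using assms by (simp add: Falsum_elim)
  next
    let ?\<Delta> = "Exists (Neg_fm (Atom (compl P))) # \<Delta>"
    have "?deriv ?\<Delta> (Exists (Neg_fm (Atom (compl P))))" using wf assms by (simp add: deriv_hd)
    then show "?deriv ?\<Delta> (Exists (Atom P))"
    proof (rule Exists_elim)
      fix \<sigma> \<Xi> x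
      let ?P = "asubst (case_nat x \<sigma>) P"
      assume \<Xi>: "ext \<sigma> ?\<Delta> \<Xi>" "?deriv \<Xi> (fsubst (case_nat x \<sigma>) (Neg_fm (Atom (compl P))))"
      have "?deriv \<Xi> (Atom ?P)"
      proof (rule dec_atom_elim[of ?P])
        fix \<Psi> assume \<Psi>: "\<Xi> \<sqsubseteq> \<Psi>" "?deriv \<Psi> (Atom (compl ?P))"
        from weaken[OF \<Xi>(2) \<Psi>(1)] have "?deriv \<Psi> (Neg_fm (Atom (compl ?P)))" by simp
        then have "?deriv \<Psi> Falsum" using \<Psi>(2) by (rule deriv.ImpE)
        then show "?deriv \<Psi> (Atom ?P)" using assms by (simp add: Falsum_elim)
      qed (use \<Xi> ext_wf assms in auto)
      then show "?deriv \<Xi> (fsubst \<sigma> (Exists (Atom P)))"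
        using deriv.ExI[of HA_EM1_minus \<Xi> x "Atom (asubst (up \<sigma>) P)"] by simp
    qed
  qed simp
qed (use assms in auto)

text \<open>The assumption concerns \<open>A\<close> itself and not its instances. Hence
  \<open>ExE\<close> is applied directly: there the bound variable stays variable 0 and
  \<open>A\<close> occurs unsubstituted.\<close>

lemma Exists_mono:
  assumes "deriv S \<Gamma> (Exists A)" "\<And>\<Delta>. deriv S \<Delta> A \<Longrightarrow> deriv S \<Delta> B"
  shows "deriv S \<Gamma> (Exists B)"
proof -
  have wf: "wf_ctx \<Gamma>" "wf_fm A" using deriv_wf[OF assms(1)] by auto
  show ?thesis
  proof (rule deriv.ExE[OF assms(1)])
    have "deriv S (A # map (fsubst shift) \<Gamma>) B" using wf by (intro assms(2) deriv_hd) auto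
    then show "deriv S (A # map (fsubst shift) \<Gamma>) (fsubst shift (Exists B))"
      unfolding fsubst.simps by (intro deriv.ExI[of _ _ "Var 0"]) (simp add: fsubst_inst_Var0)
  qed
qed

lemma EM1_minus_from_Markov:
  assumes "negative_propositional Q"
    and all: "deriv HA_MP (Forall (Atom P) # \<Gamma>) (Exists Q)"
    and ex: "deriv HA_MP (Exists (Neg_fm (Atom P)) # \<Gamma>) (Exists Q)"
  shows "deriv HA_MP \<Gamma> (Exists Q)"
proof -
  let ?deriv = "deriv HA_MP"
  have wf: "wf_atom P" "wf_ctx \<Gamma>" "wf_fm Q" using deriv_wf[OF all] by auto
  obtain R where R: "wf_atom R" "\<And>\<Gamma>. ?deriv \<Gamma> Q \<Longrightarrow> ?deriv \<Gamma> (Atom R)"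
    "\<And>\<Gamma>. ?deriv \<Gamma> (Atom R) \<Longrightarrow> ?deriv \<Gamma> Q"
    using negative_propositional_atom[OF assms(1) wf(3)] by blast
  have "?deriv \<Gamma> (Neg_fm (Neg_fm (Exists (Atom R))))"
  proof (rule Impl_intro)
    fix \<Delta> assume \<Delta>: "\<Gamma> \<sqsubseteq> \<Delta>" "?deriv \<Delta> (Neg_fm (Exists (Atom R)))"
    then have wf_\<Delta>: "wf_ctx \<Delta>" by (simp add: ext_wf)
    have no_Q: "?deriv \<Delta> (Neg_fm (Exists Q))"
    proof (rule Impl_intro)
      fix \<Theta> assume \<Theta>: "\<Delta> \<sqsubseteq> \<Theta>" "?deriv \<Theta> (Exists Q)"
      from \<Theta>(2) R(2) have "?deriv \<Theta> (Exists (Atom R))" by (rule Exists_mono)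
      with weaken[OF \<Delta>(2) \<Theta>(1)] show "?deriv \<Theta> Falsum" by (rule deriv.ImpE)
    qed (use wf wf_\<Delta> in auto)
    \<comment> \<open>One argument for both premises of the rule: what they discharge would yield a
      witness for \<open>Q\<close>, against \<open>no_Q\<close>.\<close>
    have contra: "?deriv \<Delta> (Neg_fm A)" if "?deriv (A # \<Gamma>) (Exists Q)" for A
    proof (rule Impl_intro)
      fix \<Theta> assume \<Theta>: "\<Delta> \<sqsubseteq> \<Theta>" "?deriv \<Theta> A"
      then have "?deriv \<Theta> (Impl A (Exists Q))"
        using weaken[OF weaken[OF deriv.ImpI[OF that] \<Delta>(1)]] by blast
      with \<Theta>(2) have "?deriv \<Theta> (Exists Q)" by (rule deriv.ImpE[rotated])
      with weaken[OF no_Q \<Theta>(1)] show "?deriv \<Theta> Falsum" by (rule deriv.ImpE)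
    next
      show "wf_fm A" using deriv_wf[OF that] by simp
    qed (rule wf_\<Delta>)
    have "?deriv \<Delta> (Forall (Atom P))"
    proof (rule Forall_intro[OF wf_\<Delta>])
      fix \<sigma> \<Theta> x assume \<Theta>: "ext \<sigma> \<Delta> \<Theta>"
      let ?P = "asubst (case_nat x \<sigma>) P"
      have "?deriv \<Theta> (Atom ?P)"
      proof (rule dec_atom_elim[of ?P])
        fix \<Xi> assume \<Xi>: "\<Theta> \<sqsubseteq> \<Xi>" "?deriv \<Xi> (Atom (compl ?P))"
        then have wf_\<Xi>: "wf_ctx \<Xi>" by (simp add: ext_wf)
        \<comment> \<open>The refuted existential speaks of an implication, so the complementary
          atom is first turned into one.\<close>
        have "?deriv \<Xi> (Neg_fm (Atom ?P))"
          by (rule Impl_intro) (use \<Xi> wf wf_\<Xi> in \<open>auto intro: compl_contradiction weaken\<close>)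
        then have "?deriv \<Xi> (fsubst \<sigma> (Exists (Neg_fm (Atom P))))"
          using deriv.ExI[of HA_MP \<Xi> x "Neg_fm (Atom (asubst (up \<sigma>) P))"] by simp
        moreover have "?deriv \<Xi> (Neg_fm (fsubst \<sigma> (Exists (Neg_fm (Atom P)))))"
          using deriv_ext[OF contra[OF ex] ext_weak[OF \<Theta> \<Xi>(1)]] by simp
        ultimately have "?deriv \<Xi> Falsum" by (rule deriv.ImpE[rotated])
        then show "?deriv \<Xi> (Atom ?P)" using wf by (simp add: Falsum_elim)
      qed (use \<Theta> ext_wf wf in auto)
      then show "?deriv \<Theta> (fsubst (case_nat x \<sigma>) (Atom P))" by simp
    qed
    with contra[OF all] show "?deriv \<Delta> Falsum" by (rule deriv.ImpE)
  qed (use wf R in auto)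
  with R(1) wf have "?deriv \<Gamma> (Exists (Atom R))"
    by (intro deriv.ImpE[OF deriv.MP]) (auto simp: wf_ctx_def)
  then show ?thesis using R(3) by (rule Exists_mono)
qed


section \<open>Passing between the systems\<close>

text \<open>The systems share every rule except \<open>MP\<close> and \<open>EM1_minus\<close>, so
  only the special rule of \<open>S\<close> has to be derived in \<open>T\<close>; the equations on
  \<open>S\<close> make the demand for the other rule vacuous.\<close>

lemma deriv_change_system:
  assumes "deriv S \<Gamma> A"
    and MP: "\<And>P \<Gamma>. S = HA_MP \<Longrightarrow> wf_atom P \<Longrightarrow> wf_ctx \<Gamma> \<Longrightarrow>
      deriv T \<Gamma> (Impl (Neg_fm (Neg_fm (Exists (Atom P)))) (Exists (Atom P)))"
    and EM1: "\<And>Q P \<Gamma>. S = HA_EM1_minus \<Longrightarrow> negative_propositional Q \<Longrightarrow>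
      deriv T (Forall (Atom P) # \<Gamma>) (Exists Q) \<Longrightarrow>
      deriv T (Exists (Neg_fm (Atom P)) # \<Gamma>) (Exists Q) \<Longrightarrow> deriv T \<Gamma> (Exists Q)"
  shows "deriv T \<Gamma> A"
  using assms(1)
proof (induction rule: deriv.induct)
  case (Hyp A \<Gamma>)
  from Hyp show ?case by (rule deriv.Hyp)
next
  case (AndI \<Gamma> A B)
  from AndI.IH show ?case by (rule deriv.AndI)
next
  case (AndE1 \<Gamma> A B)
  from AndE1.IH show ?case by (rule deriv.AndE1)
next
  case (AndE2 \<Gamma> A B)
  from AndE2.IH show ?case by (rule deriv.AndE2)
next
  case (OrI1 \<Gamma> A B)
  from OrI1.IH OrI1.hyps(2) show ?case by (rule deriv.OrI1)
next
  case (OrI2 \<Gamma> B A)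
  from OrI2.IH OrI2.hyps(2) show ?case by (rule deriv.OrI2)
next
  case (OrE \<Gamma> A B C)
  from OrE.IH show ?case by (rule deriv.OrE)
next
  case (ImpI A \<Gamma> B)
  from ImpI.IH show ?case by (rule deriv.ImpI)
next
  case (ImpE \<Gamma> A B)
  from ImpE.IH show ?case by (rule deriv.ImpE)
next
  case (AllI \<Gamma> A)
  from AllI.IH show ?case by (rule deriv.AllI)
next
  case (AllE \<Gamma> A t)
  from AllE.IH show ?case by (rule deriv.AllE)
next
  case (ExI \<Gamma> t A)
  from ExI.IH show ?case by (rule deriv.ExI)
next
  case (ExE \<Gamma> A C)
  from ExE.IH show ?case by (rule deriv.ExE)
next
  case (Induct \<Gamma> A t)
  from Induct.IH show ?case by (rule deriv.Induct)
next
  case (Post Ps P \<Gamma>)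
  from Post.hyps(1) _ Post.hyps(2,3) show ?case by (rule deriv.Post) (use Post.IH in simp)
next
  case (MP P \<Gamma>)
  then show ?case by (intro assms(2)) (simp_all add: wf_ctx_def)
next
  case (EM1_minus Q P \<Gamma>)
  from EM1_minus.hyps(1,2) EM1_minus.IH show ?case by (rule EM1)
qed

theorem theorem4p3:
  fixes F :: fm
  assumes "wf_fm F"
  shows "provable HA_MP F \<longleftrightarrow> provable HA_EM1_minus F"
proof
  assume "provable HA_MP F"
  then show "provable HA_EM1_minus F"
    by (rule deriv_change_system) (simp_all add: Markov_from_EM1_minus)
next
  assume "provable HA_EM1_minus F"
  then show "provable HA_MP F"
    by (rule deriv_change_system) (simp, rule EM1_minus_from_Markov)
qed

end
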